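(* Let $(x_n)$ be a basic sequence in a real Banach space $X$ with $\inf_n\|x_n\|>0$, and let $E\subseteq X^*$ be an isomorphically precisely norming set for $X$ such that \[ \sum_n |x^*(x_{n+1}-x_n)|<\infty \quad\text{for all } x^*\in E. \] Then there exists a subsequence of $(x_n)$ whose closed linear span is an isomorphically polyhedral Banach space.
   Context: A set $E \subseteq X^*$ is called isomorphically precisely norming for a Banach space $(X,\|\cdot\|)$ if there exists $C \ge 1$ such that (a) $E \subseteq C\cdot Ba(X^* )$ (where $Ba(X^* )$ is the closed unit ball of $X^*$); (b) $\frac{1}{C}\|x\| \le \sup_{e\in E}|e(x)|$ for all $x \in X$; and (c) for every $x\in X$ there is $e_0 \in E$ with $|e_0(x)| = \sup_{e\in E}|e(x)|$. An infinite dimensional Banach space is polyhedral if the closed unit ball of each of its finite dimensional subspaces has finitely many extreme points; it is isomorphically polyhedral if it is polyhedral under some equivalent norm. A sequence is basic if it is a Schauder basis of its closed linear span. *)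

theory Defs
  imports "HOL-Analysis.Analysis"
begin

definition iso_precisely_norming :: "('a::real_normed_vector \<Rightarrow>\<^sub>L real) set \<Rightarrow> bool" where
  "iso_precisely_norming E \<longleftrightarrow>
     (\<exists>C\<ge>1.
        (\<forall>e\<in>E. norm e \<le> C) \<and>
        (\<forall>x. norm x / C \<le> (SUP e\<in>E. \<bar>blinfun_apply e x\<bar>)) \<and>
        (\<forall>x. \<exists>e0\<in>E. \<bar>blinfun_apply e0 x\<bar> = (SUP e\<in>E. \<bar>blinfun_apply e x\<bar>)))"

definition basic_sequence :: "(nat \<Rightarrow> 'a::real_normed_vector) \<Rightarrow> bool" where
  "basic_sequence xs \<longleftrightarrow>
     (\<forall>x\<in>closure (span (range xs)). \<exists>!a. (\<lambda>n. a n *\<^sub>R xs n) sums x)"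

definition finite_dim_subspace :: "'a::real_vector set \<Rightarrow> bool" where
  "finite_dim_subspace F \<longleftrightarrow> (\<exists>B. finite B \<and> F = span B)"

definition norm_on :: "'a::real_vector set \<Rightarrow> ('a \<Rightarrow> real) \<Rightarrow> bool" where
  "norm_on Y N \<longleftrightarrow>
     (\<forall>y\<in>Y. 0 \<le> N y \<and> (N y = 0 \<longleftrightarrow> y = 0)) \<and>
     (\<forall>y\<in>Y. \<forall>z\<in>Y. N (y + z) \<le> N y + N z) \<and>
     (\<forall>y\<in>Y. \<forall>c. N (c *\<^sub>R y) = \<bar>c\<bar> * N y)"

definition polyhedral_under :: "'a::real_normed_vector set \<Rightarrow> ('a \<Rightarrow> real) \<Rightarrow> bool" where
  "polyhedral_under Y N \<longleftrightarrow>
     \<not> finite_dim_subspace Y \<and>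
     (\<forall>F. subspace F \<and> F \<subseteq> Y \<and> finite_dim_subspace F \<longrightarrow>
          finite {p. p extreme_point_of {y\<in>F. N y \<le> 1}})"

definition iso_polyhedral :: "'a::real_normed_vector set \<Rightarrow> bool" where
  "iso_polyhedral Y \<longleftrightarrow>
     (\<exists>N c C. norm_on Y N \<and> 0 < c \<and> 0 < C \<and>
        (\<forall>y\<in>Y. c * norm y \<le> N y \<and> N y \<le> C * norm y) \<and>
        polyhedral_under Y N)"

end

theory Submission
  imports Defs "HOL-Complex_Analysis.Great_Picard"
begin

text \<open>Passing to a subsequence gives, for \<open>y\<close> in the closed span \<open>Y\<close>, an expansion
  \<open>e y = (\<Sum>j. A y j * e (w j))\<close> with \<open>A y\<close> in \<open>c\<^sub>0\<close>, bounded by the norm of \<open>y\<close>, and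
  \<open>(\<Sum>j. \<bar>e (w j)\<bar>) < \<infinity>\<close> for all \<open>e \<in> E\<close>. If some bounded functional does not tend to \<open>0\<close> along the
  sequence, the coefficient sums of a subsequence are bounded and the \<open>w j\<close> are its successive
  differences; otherwise, or if the norms are unbounded, a sparse subsequence is itself summable
  against every \<open>e \<in> E\<close>, and the \<open>w j\<close> are its normalised terms.

  Thus \<open>E\<close> acts through sequences in \<open>\<ell>\<^sub>1\<close>. These are classified by a level \<open>k\<close>, their
  \<open>\<ell>\<^sub>1\<close>-norm rounded up, and replaced by truncations rounded to a grid, with an error that is tiny compared to
  the weight gap between \<open>1 + (1/2)^k\<close> and \<open>1 + (1/2)^(k + 1)\<close>; the weight is moreover slightly decreased in
  proportion to the \<open>\<ell>\<^sub>1\<close>-norm of the truncation. Since the supremum over \<open>E\<close> is attained at some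
  level \<open>m\<close>, levels beyond \<open>m\<close> are irrelevant near \<open>y\<close>, and since \<open>A y j\<close> tends to \<open>0\<close>, so are long
  truncations. Hence the weighted supremum is an equivalent norm which near every \<open>y \<noteq> 0\<close> is a
  maximum of finitely many linear functionals, and such a norm is polyhedral.\<close>

section \<open>Norms that are locally a maximum of linear functionals\<close>

text \<open>Bolzano-Weierstrass in a finite-dimensional span, by induction on the spanning set. The
  induction hypothesis makes \<open>span B\<close> closed, so a vector \<open>v\<close> outside it
  has positive distance to it. This distance bounds the coefficients of \<open>v\<close>, and the
  rest is a bounded sequence in \<open>span B\<close>.\<close>

lemma span_finite_bounded_subsequence:
  fixes z :: "nat \<Rightarrow> 'a::real_normed_vector"
  assumes "finite B" "\<And>n. z n \<in> span B" "\<And>n. norm (z n) \<le> R"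
  shows "\<exists>l\<in>span B. \<exists>r::nat \<Rightarrow> nat. strict_mono r \<and> (z \<circ> r) \<longlonglongrightarrow> l"
  using assms
proof (induction B arbitrary: z R rule: finite_induct)
  case empty
  then have "z = (\<lambda>_. 0)" by auto
  then have "strict_mono id \<and> (z \<circ> id) \<longlonglongrightarrow> 0" by (simp add: strict_mono_def)
  then show ?case by (intro bexI[of _ 0] exI) auto
next
  case (insert v B)
  show ?case
  proof (cases "v \<in> span B")
    case True
    then have "span (insert v B) = span B" by (simp add: span_redundant)
    then show ?thesis using insert.IH[of z R] insert.prems by simp
  next
    case False
    have "closed (span B)"
      unfolding closed_sequential_limits
    proof (intro allI impI, elim conjE)
      fix x l assume x: "\<forall>n. x n \<in> span B" and l: "x \<longlonglongrightarrow> l"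
      obtain K where K: "\<And>n. norm (x n) \<le> K"
        using convergent_imp_Bseq[of x] l unfolding Bseq_def convergent_def by blast
      obtain l' r where "l' \<in> span B" "strict_mono r" "(x \<circ> r) \<longlonglongrightarrow> l'"
        using insert.IH[of x K] x K by blast
      moreover then have "(x \<circ> r) \<longlonglongrightarrow> l" using l LIMSEQ_subseq_LIMSEQ by blast
      ultimately show "l \<in> span B" using LIMSEQ_unique by blast
    qed
    then have \<delta>: "infdist v (span B) > 0" (is "?\<delta> > 0")
      using False by (metis infdist_pos_not_in_closed span_zero empty_iff)
    have "\<forall>n. \<exists>t. z n - t *\<^sub>R v \<in> span B"
      using insert.prems(1) by (simp add: span_breakdown_eq)
    then obtain t where t: "\<And>n. z n - t n *\<^sub>R v \<in> span B" by metis
    have tb: "\<bar>t n\<bar> \<le> R / ?\<delta>" for n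
    proof (cases "t n = 0")
      case True
      have "0 \<le> R" using insert.prems(2)[of n] norm_ge_zero order_trans by blast
      then show ?thesis using True \<delta> by simp
    next
      case False
      \<comment> \<open>This point of \<open>span B\<close> differs from \<open>v\<close> by
        \<open>z n / t n\<close>, so the distance of \<open>v\<close> to the span bounds the modulus
        of \<open>t n\<close>.\<close>
      have "(-1 / t n) *\<^sub>R (z n - t n *\<^sub>R v) \<in> span B" by (intro span_scale t)
      then have "?\<delta> \<le> dist v ((-1 / t n) *\<^sub>R (z n - t n *\<^sub>R v))" by (rule infdist_le)
      also have "\<dots> = norm ((1 / t n) *\<^sub>R z n)"
        using False by (simp add: dist_norm algebra_simps)
      also have "\<dots> = norm (z n) / \<bar>t n\<bar>" by (simp add: divide_inverse)
      also have "\<dots> \<le> R / \<bar>t n\<bar>" using insert.prems(2) by (simp add: divide_right_mono)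
      finally show ?thesis using \<delta> False by (simp add: field_simps)
    qed
    then have "bounded (range t)" by (auto simp: bounded_iff)
    then obtain \<tau> r1 where r1: "strict_mono r1" "(t \<circ> r1) \<longlonglongrightarrow> \<tau>"
      using bounded_imp_convergent_subsequence by blast
    define u where "u n = z (r1 n) - t (r1 n) *\<^sub>R v" for n
    have "norm (u n) \<le> R + R / ?\<delta> * norm v" for n
    proof -
      have "norm (u n) \<le> norm (z (r1 n)) + \<bar>t (r1 n)\<bar> * norm v"
        unfolding u_def by (metis norm_scaleR norm_triangle_ineq4)
      then show ?thesis
        using insert.prems(2)[of "r1 n"] mult_right_mono[OF tb[of "r1 n"] norm_ge_zero[of v]]
        by linarith
    qed
    then obtain l r2 where r2: "l \<in> span B" "strict_mono r2" "(u \<circ> r2) \<longlonglongrightarrow> l"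
      using insert.IH[of u] t unfolding u_def by metis
    have "(\<lambda>n. (t \<circ> r1) (r2 n) *\<^sub>R v + (u \<circ> r2) n) \<longlonglongrightarrow> \<tau> *\<^sub>R v + l"
      by (intro tendsto_intros r2 LIMSEQ_subseq_LIMSEQ[OF r1(2) r2(2), unfolded o_def]
          | use LIMSEQ_subseq_LIMSEQ[OF r1(2) r2(2)] in \<open>simp add: o_def\<close>)+
    then have "(z \<circ> (r1 \<circ> r2)) \<longlonglongrightarrow> \<tau> *\<^sub>R v + l" by (simp add: u_def o_def)
    moreover have "\<tau> *\<^sub>R v + l \<in> span (insert v B)"
      using r2(1) by (simp add: span_breakdown_eq exI[of _ \<tau>])
    moreover have "strict_mono (r1 \<circ> r2)" using r1(1) r2(2) by (rule strict_mono_o)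
    ultimately show ?thesis by blast
  qed
qed

text \<open>Linearity is asked on \<open>Y\<close> only: the coordinates used later are built from
  \<open>coef\<close>, which is unspecified off the closed span.\<close>

definition lin_on :: "'a::real_vector set \<Rightarrow> ('a \<Rightarrow> real) \<Rightarrow> bool" where
  "lin_on Y l \<longleftrightarrow> (\<forall>u\<in>Y. \<forall>v\<in>Y. l (u + v) = l u + l v) \<and> (\<forall>u\<in>Y. \<forall>c. l (c *\<^sub>R u) = c * l u)"

definition max_of_linear :: "'a::real_vector set \<Rightarrow> 'a set \<Rightarrow> ('a \<Rightarrow> real) \<Rightarrow> bool" where
  "max_of_linear Y U f \<longleftrightarrow> (\<exists>L. finite L \<and> (\<forall>l\<in>L. lin_on Y l \<and> (\<forall>z\<in>U. l z \<le> f z)) \<and>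
     (\<forall>z\<in>U. \<exists>l\<in>L. f z = l z))"

text \<open>Two extreme points with the same active functionals coincide: otherwise one of them could
  be moved in both directions along their difference.\<close>

lemma finite_extreme_points_local:
  fixes N :: "'a::real_normed_vector \<Rightarrow> real"
  assumes "subspace F" "F \<subseteq> Y" "0 < \<rho>"
    and max: "max_of_linear Y (Y \<inter> ball y \<rho>) N"
  shows "finite {p \<in> ball y \<rho>. N p = 1 \<and> p extreme_point_of {x \<in> F. N x \<le> 1}}" (is "finite ?P")
proof -
  let ?U = "Y \<inter> ball y \<rho>"
  obtain L where L: "finite L" "\<And>l. l \<in> L \<Longrightarrow> lin_on Y l" "\<And>l z. l \<in> L \<Longrightarrow> z \<in> ?U \<Longrightarrow> l z \<le> N z"
    "\<And>z. z \<in> ?U \<Longrightarrow> \<exists>l\<in>L. N z = l z"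
    using max unfolding max_of_linear_def by blast
  define act where "act p = {l \<in> L. l p = 1}" for p
  have "inj_on act ?P"
  proof (rule inj_onI, rule ccontr)
    fix p q assume p: "p \<in> ?P" and q: "q \<in> ?P" and eq: "act p = act q" and ne: "p \<noteq> q"
    have F: "p \<in> F" "q \<in> F" using p q by (auto simp: extreme_point_of_def)
    define d where "d = p - q"
    have d: "d \<in> F" "d \<noteq> 0" using F ne assms(1) by (auto simp: d_def subspace_diff)
    have FY: "p \<in> Y" "q \<in> Y" "d \<in> Y" using F d assms(2) by auto
    have ld: "l (p + t *\<^sub>R d) = l p + t * (l p - l q)" if "l \<in> L" for l t
    proof -
      have "t *\<^sub>R d \<in> Y" using d(1) assms(1,2) subspace_scale by blast
      moreover have "l d = l p - l q"
      proof -
        have "l (d + q) = l d + l q" using L(2)[OF that] FY unfolding lin_on_def by blast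
        then show ?thesis by (simp add: d_def)
      qed
      ultimately show ?thesis using L(2)[OF that] FY unfolding lin_on_def by metis
    qed
    have "\<forall>\<^sub>F t in at 0. p + t *\<^sub>R d \<in> ball y \<rho>" for t :: real
    proof -
      have "((\<lambda>t::real. p + t *\<^sub>R d) \<longlongrightarrow> p + 0 *\<^sub>R d) (at 0)" by (intro tendsto_intros)
      then show ?thesis using p by (intro topological_tendstoD) auto
    qed
    moreover have "\<forall>\<^sub>F t in at 0. \<forall>l\<in>L. l \<notin> act p \<longrightarrow> l (p + t *\<^sub>R d) < 1"
    proof (intro eventually_ball_finite ballI L(1))
      fix l assume l: "l \<in> L"
      show "\<forall>\<^sub>F t in at (0::real). l \<notin> act p \<longrightarrow> l (p + t *\<^sub>R d) < 1"
      proof (cases "l \<in> act p")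
        case False
        then have "l p < 1" using L(3)[OF l, of p] p FY l by (force simp: act_def)
        moreover have "((\<lambda>t::real. l p + t * (l p - l q)) \<longlongrightarrow> l p + 0 * (l p - l q)) (at 0)"
          by (intro tendsto_intros)
        ultimately show ?thesis
          using ld[OF l] by (simp add: order_tendstoD(2))
      qed auto
    qed
    ultimately have "\<forall>\<^sub>F t in at 0. p + t *\<^sub>R d \<in> ball y \<rho> \<and>
        (\<forall>l\<in>L. l \<notin> act p \<longrightarrow> l (p + t *\<^sub>R d) < 1)"
      by (rule eventually_conj)
    then obtain e :: real where e: "e > 0" "\<And>t. t \<noteq> 0 \<Longrightarrow> \<bar>t\<bar> < e \<Longrightarrow> p + t *\<^sub>R d \<in> ball y \<rho> \<and>
        (\<forall>l\<in>L. l \<notin> act p \<longrightarrow> l (p + t *\<^sub>R d) < 1)"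
      unfolding eventually_at by (auto simp: dist_real_def)
    have inB: "p + t *\<^sub>R d \<in> {x \<in> F. N x \<le> 1}" if t: "t \<noteq> 0" "\<bar>t\<bar> < e" for t
    proof -
      have inF: "p + t *\<^sub>R d \<in> F" using F d assms(1) by (simp add: subspace_add subspace_scale)
      then have "p + t *\<^sub>R d \<in> ?U" using assms(2) e(2)[OF t] by auto
      then obtain l where l: "l \<in> L" "N (p + t *\<^sub>R d) = l (p + t *\<^sub>R d)" using L(4) by blast
      \<comment> \<open>A functional active at \<open>p\<close> is active at \<open>q\<close> too,
        hence constant along \<open>d\<close>; the others stay below 1 for small
        \<open>t\<close>.\<close>
      have "l (p + t *\<^sub>R d) \<le> 1"
      proof (cases "l \<in> act p")
        case True
        then have "l p = 1" "l q = 1" using eq by (auto simp: act_def)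
        then show ?thesis using ld[OF l(1)] by simp
      next
        case False
        then show ?thesis using e(2)[OF t] l(1) by fastforce
      qed
      then show ?thesis using l(2) inF by simp
    qed
    have "p \<in> open_segment (p + (e/2) *\<^sub>R d) (p + (-e/2) *\<^sub>R d)"
    proof -
      have "p + (e/2) *\<^sub>R d \<noteq> p + (-e/2) *\<^sub>R d"
        using d(2) e(1) by (metis add_left_cancel divide_minus_left half_gt_zero less_numeral_extra(3)
            minus_zero neg_equal_zero scaleR_cancel_right)
      moreover have "p = (1 - 1/2) *\<^sub>R (p + (e/2) *\<^sub>R d) + (1/2) *\<^sub>R (p + (-e/2) *\<^sub>R d)"
        by (simp add: algebra_simps scaleR_half_double flip: scaleR_add_left)
      ultimately show ?thesis unfolding in_segment by (intro conjI exI[of _ "1/2::real"]) auto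
    qed
    moreover have "p + (e/2) *\<^sub>R d \<in> {x \<in> F. N x \<le> 1}" "p + (-e/2) *\<^sub>R d \<in> {x \<in> F. N x \<le> 1}"
      using inB[of "e/2"] inB[of "-e/2"] e(1) by auto
    ultimately show False using p unfolding extreme_point_of_def by blast
  qed
  moreover have "act ` ?P \<subseteq> Pow L" by (auto simp: act_def)
  ultimately show ?thesis using L(1) by (meson finite_Pow_iff finite_imageD finite_subset)
qed

text \<open>Infinitely many extreme points would accumulate at some nonzero \<open>l\<close> in
  \<open>F\<close>, by compactness in finite dimension. Near \<open>l\<close> the norm is a maximum
  of finitely many functionals, which leaves room for finitely many extreme points only.\<close>

lemma polyhedral_under_locally_max_of_linear:
  fixes Y :: "'a::real_normed_vector set"
  assumes Y: "subspace Y" and N: "norm_on Y N" and "0 < c" "\<And>y. y \<in> Y \<Longrightarrow> c * norm y \<le> N y"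
    and loc: "\<And>y. y \<in> Y \<Longrightarrow> y \<noteq> 0 \<Longrightarrow> \<exists>\<rho>>0. max_of_linear Y (Y \<inter> ball y \<rho>) N"
    and F: "subspace F" "F \<subseteq> Y" "finite_dim_subspace F"
    and C: "\<And>y. y \<in> Y \<Longrightarrow> N y \<le> C * norm y"
  shows "finite {p. p extreme_point_of {y \<in> F. N y \<le> 1}}" (is "finite ?E")
proof (rule ccontr)
  assume inf: "infinite ?E"
  let ?P = "?E - {0}"
  have "infinite ?P" using inf by simp
  then obtain p :: "nat \<Rightarrow> 'a" where p: "inj p" "range p \<subseteq> ?P"
    using infinite_countable_subset by blast
  have Nh: "N (a *\<^sub>R y) = \<bar>a\<bar> * N y" if "y \<in> Y" for a y using N that unfolding norm_on_def by blast
  have pF: "p n \<in> F" "p n \<in> Y" "p n \<noteq> 0" "N (p n) \<le> 1" for n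
    using p(2) F(2) by (auto simp: extreme_point_of_def)
  \<comment> \<open>A nonzero point with \<open>N\<close> below 1 lies strictly between 0 and its
    normalisation, so it is not extreme.\<close>
  have N1: "N (p n) = 1" for n
  proof (rule ccontr)
    assume "N (p n) \<noteq> 1"
    then have lt: "N (p n) < 1" using pF by (simp add: less_le)
    have pos: "N (p n) > 0" using N pF unfolding norm_on_def by (metis less_le)
    let ?q = "(1 / N (p n)) *\<^sub>R p n"
    have "?q \<in> F" using F(1) pF by (simp add: subspace_scale)
    moreover have "N ?q = 1" using Nh[of "p n" "1 / N (p n)"] pF pos by simp
    moreover have "0 \<in> F" "N 0 = 0" using F(1) Y N subspace_0 unfolding norm_on_def by auto
    moreover have "p n \<in> open_segment 0 ?q"
      unfolding in_segment using pF pos lt by (intro conjI exI[of _ "N (p n)"]) auto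
    moreover have "p n extreme_point_of {y \<in> F. N y \<le> 1}" using p(2) by auto
    ultimately show False unfolding extreme_point_of_def by auto
  qed
  obtain B where B: "finite B" "F = span B" using F(3) unfolding finite_dim_subspace_def by blast
  have "norm (p n) \<le> 1 / c" for n
    using assms(4)[OF pF(2)[of n]] N1[of n] \<open>0 < c\<close> by (simp add: field_simps)
  then obtain l r where l: "l \<in> F" "strict_mono r" "(p \<circ> r) \<longlonglongrightarrow> l"
    using span_finite_bounded_subsequence[OF B(1), of p "1/c"] pF(1) B(2) by auto
  \<comment> \<open>\<open>N\<close> is 1 along the sequence and dominated by
    \<open>C * norm\<close>, so the norms stay away from 0.\<close>
  have "l \<noteq> 0"
  proof
    assume "l = 0"
    then have "(\<lambda>n. C * norm ((p \<circ> r) n)) \<longlonglongrightarrow> C * norm (0::'a)"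
      using l(3) tendsto_mult_left[OF tendsto_norm, of "p \<circ> r" 0 sequentially C] by simp
    moreover have "C * norm ((p \<circ> r) n) \<ge> 1" for n using C[OF pF(2)] N1 by (metis comp_apply)
    ultimately have "C * norm (0::'a) \<ge> 1" by (meson LIMSEQ_le_const)
    then show False by simp
  qed
  then obtain \<rho> where \<rho>: "\<rho> > 0" "max_of_linear Y (Y \<inter> ball l \<rho>) N" using loc l(1) F(2) by blast
  let ?Q = "{q \<in> ball l \<rho>. N q = 1 \<and> q extreme_point_of {x \<in> F. N x \<le> 1}}"
  have fin: "finite ?Q" by (rule finite_extreme_points_local[OF F(1,2) \<rho>])
  obtain n0 where n0: "\<And>n. n \<ge> n0 \<Longrightarrow> dist ((p \<circ> r) n) l < \<rho>"
    using l(3) \<rho>(1) unfolding lim_sequentially by blast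
  have "(p \<circ> r) ` {n0..} \<subseteq> ?Q"
    using n0 N1 p(2) by (force simp: dist_commute)
  moreover have "inj (p \<circ> r)"
    using p(1) l(2) by (simp add: inj_compose strict_mono_imp_inj_on)
  ultimately have "finite {n0..}" using fin by (meson finite_imageD finite_subset inj_on_subset subset_UNIV)
  then show False by (simp add: infinite_Ici)
qed

section \<open>Renorming a space of null sequences\<close>

text \<open>\<open>A\<close> maps \<open>Y\<close> boundedly into the null sequences. In the
  application \<open>H\<close> consists of the norming functionals and their negatives, read as
  absolutely summable sequences; the symmetry of \<open>H\<close> replaces the absolute values in
  the definition of precisely norming.\<close>

locale c0_model =
  fixes Y :: "'a::real_normed_vector set" and A :: "'a \<Rightarrow> nat \<Rightarrow> real"
    and H :: "(nat \<Rightarrow> real) set" and c C :: real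
  assumes Y: "subspace Y"
    and lin: "\<And>j. lin_on Y (\<lambda>y. A y j)"
    and bound: "\<And>y j. y \<in> Y \<Longrightarrow> \<bar>A y j\<bar> \<le> c * norm y"
    and null: "\<And>y. y \<in> Y \<Longrightarrow> A y \<longlonglongrightarrow> 0"
    and l1: "\<And>h. h \<in> H \<Longrightarrow> summable (\<lambda>j. \<bar>h j\<bar>)"
    and sym: "\<And>h. h \<in> H \<Longrightarrow> (\<lambda>j. - h j) \<in> H"
    and c1: "1 \<le> c" and C1: "1 \<le> C"
    and upper: "\<And>y h. y \<in> Y \<Longrightarrow> h \<in> H \<Longrightarrow> (\<Sum>j. h j * A y j) \<le> C * norm y"
    and attained: "\<And>y. y \<in> Y \<Longrightarrow> \<exists>h\<in>H. norm y / C \<le> (\<Sum>j. h j * A y j) \<and>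
      (\<forall>g\<in>H. (\<Sum>j. g j * A y j) \<le> (\<Sum>j. h j * A y j))"
begin

definition pair :: "(nat \<Rightarrow> real) \<Rightarrow> 'a \<Rightarrow> real" where
  "pair h y = (\<Sum>j. h j * A y j)"

definition \<nu> :: "'a \<Rightarrow> real" where
  "\<nu> y = (SUP h\<in>H. pair h y)"

definition lev :: "(nat \<Rightarrow> real) \<Rightarrow> nat" where
  "lev h = nat \<lceil>\<Sum>j. \<bar>h j\<bar>\<rceil>"

text \<open>The divisor makes both \<open>eps k * c * C\<close> and \<open>eps k * k\<close> at most
  \<open>(1/2)^k / 32\<close>. The first turns errors measured by \<open>c * norm y\<close> into a
  small fraction of \<open>\<nu> y\<close>, the second bounds the penalty in the weight at level
  \<open>k\<close>.\<close>

definition eps :: "nat \<Rightarrow> real" where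
  "eps k = (1/2) ^ k / (32 * (real k + 1) * c * C)"

text \<open>Rounding goes towards 0, so absolute values do not grow and rounding commutes with
  negation. The mesh halves with each coordinate, which keeps the total error at most
  \<open>eps / 4\<close>, while every coordinate takes finitely many values at a given
  level.\<close>

definition rnd :: "(nat \<Rightarrow> real) \<Rightarrow> nat \<Rightarrow> real" where
  "rnd h j = (let \<theta> = eps (lev h) * (1/2) ^ (j + 3) in \<theta> * (sgn (h j) * of_int \<lfloor>\<bar>h j\<bar> / \<theta>\<rfloor>))"

definition trunc :: "(nat \<Rightarrow> real) \<Rightarrow> nat \<Rightarrow> 'a \<Rightarrow> real" where
  "trunc h n y = (\<Sum>j<n. rnd h j * A y j)"

definition good :: "(nat \<Rightarrow> real) \<Rightarrow> nat \<Rightarrow> bool" where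
  "good h n \<longleftrightarrow> (\<forall>y\<in>Y. trunc h n y \<le> \<nu> y + eps (lev h) * (c * norm y))"

definition wt :: "(nat \<Rightarrow> real) \<Rightarrow> nat \<Rightarrow> real" where
  "wt h n = (1 + (1/2) ^ lev h) * (1 - eps (lev h) * (\<Sum>j<n. \<bar>rnd h j\<bar>))"

definition I :: "((nat \<Rightarrow> real) \<times> nat) set" where
  "I = {(h, n). h \<in> H \<and> good h n}"

definition \<Phi> :: "(nat \<Rightarrow> real) \<times> nat \<Rightarrow> 'a \<Rightarrow> real" where
  "\<Phi> i y = wt (fst i) (snd i) * trunc (fst i) (snd i) y"

definition N :: "'a \<Rightarrow> real" where
  "N y = (SUP i\<in>I. \<Phi> i y)"

section \<open>Estimates for the constants, for \<open>\<nu>\<close> and for the rounding\<close>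

lemma eps_pos: "eps k > 0"
  using c1 C1 by (simp add: eps_def)

lemma eps_bound: "eps k * ((real k + 1) * (c * C)) = (1/2) ^ k / 32"
proof -
  define D where "D = (real k + 1) * (c * C)"
  have "D \<noteq> 0" using c1 C1 by (simp add: D_def)
  moreover have "eps k = (1/2) ^ k / (32 * D)" by (simp add: eps_def D_def mult.assoc)
  ultimately show ?thesis unfolding D_def[symmetric] by simp
qed

lemma eps_c_le: "eps k * c * C \<le> (1/2) ^ k / 32"
proof -
  have "eps k * (c * C) * 1 \<le> eps k * (c * C) * (real k + 1)"
    using eps_pos[of k] c1 C1 by (intro mult_left_mono) auto
  then show ?thesis using eps_bound[of k] by (simp add: mult_ac)
qed

lemma eps_k_le: "eps k * real k \<le> (1/2) ^ k / 32"
proof -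
  have "1 \<le> c * C" using c1 C1 mult_mono[of 1 c 1 C] by simp
  then have "real k * 1 \<le> (real k + 1) * (c * C)" by (intro mult_mono) auto
  then have "eps k * (real k * 1) \<le> eps k * ((real k + 1) * (c * C))"
    using eps_pos[of k] by (intro mult_left_mono) auto
  then show ?thesis using eps_bound[of k] by simp
qed

lemma H_nonempty: "H \<noteq> {}"
  using attained[of 0] Y subspace_0 by blast

lemma pair_le: "y \<in> Y \<Longrightarrow> h \<in> H \<Longrightarrow> pair h y \<le> \<nu> y"
  unfolding \<nu>_def by (rule cSUP_upper) (use upper pair_def in \<open>auto intro!: bdd_aboveI[of _ "C * norm y"]\<close>)

lemma \<nu>_le: "y \<in> Y \<Longrightarrow> \<nu> y \<le> C * norm y"
  unfolding \<nu>_def by (rule cSUP_least) (use H_nonempty upper pair_def in auto)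

lemma \<nu>_attained: "y \<in> Y \<Longrightarrow> \<exists>h\<in>H. norm y / C \<le> \<nu> y \<and> \<nu> y = pair h y"
proof -
  assume y: "y \<in> Y"
  then obtain h where h: "h \<in> H" "norm y / C \<le> pair h y" "\<And>g. g \<in> H \<Longrightarrow> pair g y \<le> pair h y"
    using attained unfolding pair_def by blast
  have "\<nu> y \<le> pair h y" unfolding \<nu>_def by (rule cSUP_least) (use H_nonempty h in auto)
  then show ?thesis using h pair_le[OF y h(1)] by (intro bexI[of _ h]) auto
qed

lemma norm_le_\<nu>: "y \<in> Y \<Longrightarrow> norm y \<le> C * \<nu> y"
proof -
  assume "y \<in> Y"
  then have "norm y / C \<le> \<nu> y" using \<nu>_attained by blast
  then show ?thesis using C1 by (simp add: pos_divide_le_eq mult.commute)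
qed

lemma \<nu>_nonneg: "y \<in> Y \<Longrightarrow> 0 \<le> \<nu> y"
proof -
  assume "y \<in> Y"
  then have "norm y / C \<le> \<nu> y" using \<nu>_attained by blast
  moreover have "0 \<le> norm y / C" using C1 by simp
  ultimately show ?thesis by simp
qed

lemma summable_pair: "y \<in> Y \<Longrightarrow> h \<in> H \<Longrightarrow> summable (\<lambda>j. h j * A y j)"
proof (rule summable_comparison_test')
  assume y: "y \<in> Y" and h: "h \<in> H"
  show "summable (\<lambda>j. \<bar>h j\<bar> * (c * norm y))" by (rule summable_mult2[OF l1[OF h]])
  show "norm (h j * A y j) \<le> \<bar>h j\<bar> * (c * norm y)" if "0 \<le> j" for j
    using mult_left_mono[OF bound[OF y, of j], of "\<bar>h j\<bar>"] by (simp add: abs_mult)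
qed

lemma A_add: "u \<in> Y \<Longrightarrow> v \<in> Y \<Longrightarrow> A (u + v) j = A u j + A v j"
  using lin[of j] by (auto simp: lin_on_def)

lemma A_scale: "u \<in> Y \<Longrightarrow> A (t *\<^sub>R u) j = t * A u j"
  using lin[of j] by (auto simp: lin_on_def)

lemma pair_add: "u \<in> Y \<Longrightarrow> v \<in> Y \<Longrightarrow> h \<in> H \<Longrightarrow> pair h (u + v) = pair h u + pair h v"
  unfolding pair_def by (subst suminf_add) (simp_all add: A_add distrib_left summable_pair)

lemma sum_abs_le: "h \<in> H \<Longrightarrow> finite J \<Longrightarrow> (\<Sum>j\<in>J. \<bar>h j\<bar>) \<le> lev h"
  using sum_le_suminf[OF l1, of h J] unfolding lev_def by linarith

lemma abs_rnd_le: "\<bar>rnd h j\<bar> \<le> \<bar>h j\<bar>"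
proof -
  define \<theta> where "\<theta> = eps (lev h) * (1/2) ^ (j + 3)"
  have "\<theta> > 0" using eps_pos by (simp add: \<theta>_def)
  have r: "rnd h j = \<theta> * (sgn (h j) * of_int \<lfloor>\<bar>h j\<bar> / \<theta>\<rfloor>)" by (simp add: rnd_def \<theta>_def Let_def)
  have fl: "0 \<le> real_of_int \<lfloor>\<bar>h j\<bar> / \<theta>\<rfloor>" "real_of_int \<lfloor>\<bar>h j\<bar> / \<theta>\<rfloor> \<le> \<bar>h j\<bar> / \<theta>"
    using \<open>\<theta> > 0\<close> by auto
  have "\<bar>rnd h j\<bar> \<le> \<theta> * real_of_int \<lfloor>\<bar>h j\<bar> / \<theta>\<rfloor>"
    using \<open>\<theta> > 0\<close> fl(1) by (auto simp: r abs_mult sgn_if)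
  also have "\<dots> \<le> \<theta> * (\<bar>h j\<bar> / \<theta>)" using fl(2) \<open>\<theta> > 0\<close> by (intro mult_left_mono) auto
  finally show ?thesis using \<open>\<theta> > 0\<close> by simp
qed

lemma rnd_diff_le: "\<bar>rnd h j - h j\<bar> \<le> eps (lev h) * (1/2) ^ (j + 3)"
proof -
  define \<theta> where "\<theta> = eps (lev h) * (1/2) ^ (j + 3)"
  have "\<theta> > 0" using eps_pos by (simp add: \<theta>_def)
  have r: "rnd h j = \<theta> * (sgn (h j) * of_int \<lfloor>\<bar>h j\<bar> / \<theta>\<rfloor>)" by (simp add: rnd_def \<theta>_def Let_def)
  have fl: "\<theta> * real_of_int \<lfloor>\<bar>h j\<bar> / \<theta>\<rfloor> \<le> \<bar>h j\<bar>" "\<bar>h j\<bar> \<le> \<theta> * real_of_int \<lfloor>\<bar>h j\<bar> / \<theta>\<rfloor> + \<theta>"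
  proof -
    have "real_of_int \<lfloor>\<bar>h j\<bar> / \<theta>\<rfloor> \<le> \<bar>h j\<bar> / \<theta>" "\<bar>h j\<bar> / \<theta> \<le> real_of_int \<lfloor>\<bar>h j\<bar> / \<theta>\<rfloor> + 1"
      using floor_correct[of "\<bar>h j\<bar> / \<theta>"] by linarith+
    then show "\<theta> * real_of_int \<lfloor>\<bar>h j\<bar> / \<theta>\<rfloor> \<le> \<bar>h j\<bar>" "\<bar>h j\<bar> \<le> \<theta> * real_of_int \<lfloor>\<bar>h j\<bar> / \<theta>\<rfloor> + \<theta>"
      unfolding pos_le_divide_eq[OF \<open>\<theta> > 0\<close>] pos_divide_le_eq[OF \<open>\<theta> > 0\<close>]
      by (simp_all add: algebra_simps)
  qed
  show ?thesis unfolding \<theta>_def[symmetric]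
    using fl \<open>\<theta> > 0\<close> by (auto simp: r sgn_if abs_if)
qed

lemma rnd_uminus: "rnd (\<lambda>j. - h j) = (\<lambda>j. - rnd h j)"
  by (auto simp: rnd_def lev_def Let_def fun_eq_iff)

lemma sum_rnd_diff_le:
  assumes "finite J" shows "(\<Sum>j\<in>J. \<bar>rnd h j - h j\<bar>) \<le> eps (lev h) / 4"
proof -
  have "(1/2::real) ^ (j + 3) = 1/8 * (1/2) ^ j" for j by (simp add: power_add power3_eq_cube)
  moreover have "(\<lambda>j. eps (lev h) * (1/8 * (1/2::real) ^ j)) sums (eps (lev h) * (1/8 * 2))"
    using geometric_sums[of "1/2::real"] by (intro sums_mult) simp
  ultimately have s: "(\<lambda>j. eps (lev h) * (1/2::real) ^ (j + 3)) sums (eps (lev h) * ((1/8) * 2))"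
    by (simp only:)
  have "(\<Sum>j\<in>J. \<bar>rnd h j - h j\<bar>) \<le> (\<Sum>j\<in>J. eps (lev h) * (1/2) ^ (j + 3))"
    by (intro sum_mono rnd_diff_le)
  also have "\<dots> \<le> (\<Sum>j. eps (lev h) * (1/2) ^ (j + 3))"
    using s eps_pos[of "lev h"] by (intro sum_le_suminf assms) (auto simp: sums_iff less_imp_le)
  finally show ?thesis using s by (simp add: sums_iff)
qed

lemma sum_abs_rnd_le: "h \<in> H \<Longrightarrow> finite J \<Longrightarrow> (\<Sum>j\<in>J. \<bar>rnd h j\<bar>) \<le> lev h"
  using sum_mono[of J "\<lambda>j. \<bar>rnd h j\<bar>" "\<lambda>j. \<bar>h j\<bar>"] sum_abs_le[of h J] abs_rnd_le[of h] by fastforce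

section \<open>Truncation errors and good lengths\<close>

lemma abs_sum_A_le:
  assumes "y \<in> Y" shows "\<bar>\<Sum>j\<in>J. g j * A y j\<bar> \<le> (\<Sum>j\<in>J. \<bar>g j\<bar>) * (c * norm y)"
proof -
  have "\<bar>\<Sum>j\<in>J. g j * A y j\<bar> \<le> (\<Sum>j\<in>J. \<bar>g j\<bar> * (c * norm y))"
  proof (rule order_trans[OF sum_abs sum_mono])
    fix j
    show "\<bar>g j * A y j\<bar> \<le> \<bar>g j\<bar> * (c * norm y)"
      using mult_left_mono[OF bound[OF assms, of j], of "\<bar>g j\<bar>"] by (simp add: abs_mult)
  qed
  then show ?thesis by (simp add: sum_distrib_right)
qed

text \<open>The error is controlled by the coordinates of \<open>y\<close> rather than by the tail
  of \<open>h\<close>, so one cut-off \<open>n\<close> serves all \<open>h\<close> of a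
  level.\<close>

lemma pair_tail_le:
  fixes \<kappa> :: real
  assumes "y \<in> Y" "h \<in> H" "\<And>j. n \<le> j \<Longrightarrow> \<bar>A y j\<bar> \<le> \<kappa>"
  shows "\<bar>pair h y - (\<Sum>j<n. h j * A y j)\<bar> \<le> lev h * \<kappa>"
proof (rule LIMSEQ_le_const2)
  show "(\<lambda>M. \<bar>(\<Sum>j<M. h j * A y j) - (\<Sum>j<n. h j * A y j)\<bar>)
      \<longlonglongrightarrow> \<bar>pair h y - (\<Sum>j<n. h j * A y j)\<bar>"
    unfolding pair_def by (intro tendsto_intros summable_LIMSEQ summable_pair assms)
  have "\<bar>(\<Sum>j<M. h j * A y j) - (\<Sum>j<n. h j * A y j)\<bar> \<le> lev h * \<kappa>" if "n \<le> M" for M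
  proof -
    have "(\<Sum>j<M. h j * A y j) - (\<Sum>j<n. h j * A y j) = (\<Sum>j\<in>{n..<M}. h j * A y j)"
      using sum_diff_nat_ivl[of 0 n M "\<lambda>j. h j * A y j"] that by (simp add: lessThan_atLeast0)
    also have "\<bar>\<dots>\<bar> \<le> (\<Sum>j\<in>{n..<M}. \<bar>h j\<bar> * \<kappa>)"
    proof (rule order_trans[OF sum_abs sum_mono])
      fix j assume "j \<in> {n..<M}"
      then show "\<bar>h j * A y j\<bar> \<le> \<bar>h j\<bar> * \<kappa>"
        using mult_left_mono[OF assms(3)[of j], of "\<bar>h j\<bar>"] by (simp add: abs_mult)
    qed
    also have "\<dots> = (\<Sum>j\<in>{n..<M}. \<bar>h j\<bar>) * \<kappa>" by (simp add: sum_distrib_right)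
    also have "\<dots> \<le> lev h * \<kappa>"
      using assms(3)[of n] sum_abs_le[OF assms(2)] by (intro mult_right_mono) auto
    finally show ?thesis .
  qed
  then show "\<exists>k. \<forall>M\<ge>k. \<bar>(\<Sum>j<M. h j * A y j) - (\<Sum>j<n. h j * A y j)\<bar> \<le> lev h * \<kappa>" by blast
qed

text \<open>Rounding and cutting off each cost at most \<open>eps / 4\<close> times
  \<open>c * norm y\<close>. The first conclusion makes such lengths admissible, the second keeps
  almost the full value of \<open>pair h y\<close>.\<close>

lemma good_if_close:
  assumes h: "h \<in> H" and n: "(\<Sum>j. \<bar>h (j + n)\<bar>) \<le> eps (lev h) / 4"
  shows "good h n" "y \<in> Y \<Longrightarrow> pair h y - eps (lev h) * (c * norm y) \<le> trunc h n y"
proof -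
  have *: "\<bar>trunc h n y - pair h y\<bar> \<le> eps (lev h) * (c * norm y)" if y: "y \<in> Y" for y
  proof -
    have "trunc h n y - (\<Sum>j<n. h j * A y j) = (\<Sum>j<n. (rnd h j - h j) * A y j)"
      by (simp add: trunc_def sum_subtractf left_diff_distrib)
    also have "\<bar>\<dots>\<bar> \<le> (\<Sum>j<n. \<bar>rnd h j - h j\<bar>) * (c * norm y)" by (rule abs_sum_A_le[OF y])
    also have "\<dots> \<le> eps (lev h) / 4 * (c * norm y)"
      using c1 by (intro mult_right_mono sum_rnd_diff_le) auto
    finally have "\<bar>trunc h n y - (\<Sum>j<n. h j * A y j)\<bar> \<le> eps (lev h) / 4 * (c * norm y)" .
    moreover have "\<bar>pair h y - (\<Sum>j<n. h j * A y j)\<bar> \<le> eps (lev h) / 4 * (c * norm y)"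
    proof -
      have "pair h y - (\<Sum>j<n. h j * A y j) = (\<Sum>j. h (j + n) * A y (j + n))"
        unfolding pair_def using suminf_minus_initial_segment[OF summable_pair[OF y h]] by simp
      also have "\<bar>\<dots>\<bar> \<le> (\<Sum>j. \<bar>h (j + n)\<bar> * (c * norm y))"
      proof -
        have s: "summable (\<lambda>j. \<bar>h (j + n)\<bar> * (c * norm y))"
          by (intro summable_mult2 summable_ignore_initial_segment l1 h)
        have le: "\<bar>h (j + n) * A y (j + n)\<bar> \<le> \<bar>h (j + n)\<bar> * (c * norm y)" for j
          using mult_left_mono[OF bound[OF y, of "j + n"], of "\<bar>h (j + n)\<bar>"] by (simp add: abs_mult)
        have "summable (\<lambda>j. \<bar>h (j + n) * A y (j + n)\<bar>)"
          by (rule summable_rabs_comparison_test[OF _ s]) (use le in auto)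
        then have "\<bar>\<Sum>j. h (j + n) * A y (j + n)\<bar> \<le> (\<Sum>j. \<bar>h (j + n) * A y (j + n)\<bar>)"
          "(\<Sum>j. \<bar>h (j + n) * A y (j + n)\<bar>) \<le> (\<Sum>j. \<bar>h (j + n)\<bar> * (c * norm y))"
          by (rule summable_rabs, rule suminf_le[OF le _ s])
        then show ?thesis by (rule order_trans)
      qed
      also have "\<dots> = (\<Sum>j. \<bar>h (j + n)\<bar>) * (c * norm y)"
        by (rule suminf_mult2[OF summable_ignore_initial_segment[OF l1[OF h]], symmetric])
      also have "\<dots> \<le> eps (lev h) / 4 * (c * norm y)" using n c1 by (intro mult_right_mono) auto
      finally show ?thesis .
    qed
    moreover have "0 \<le> eps (lev h) * (c * norm y)" using eps_pos[of "lev h"] c1 by simp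
    ultimately show ?thesis by linarith
  qed
  show "good h n" unfolding good_def
  proof
    fix y assume "y \<in> Y"
    then show "trunc h n y \<le> \<nu> y + eps (lev h) * (c * norm y)"
      using *[of y] pair_le[OF _ h, of y] by linarith
  qed
  show "y \<in> Y \<Longrightarrow> pair h y - eps (lev h) * (c * norm y) \<le> trunc h n y"
    using *[of y] by (auto simp: abs_le_iff)
qed

lemma ex_close:
  assumes h: "h \<in> H"
  shows "\<exists>n. (\<Sum>j. \<bar>h (j + n)\<bar>) \<le> eps (lev h) / 4"
proof -
  obtain n where "\<forall>m\<ge>n. norm (\<Sum>j. \<bar>h (j + m)\<bar>) < eps (lev h) / 4"
    using suminf_exist_split[OF _ l1[OF h], of "eps (lev h) / 4"] eps_pos[of "lev h"] by auto
  then show ?thesis by (intro exI[of _ n]) (auto simp: less_imp_le)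
qed

text \<open>A compactness argument: a sequence of violating \<open>h\<close> would have a coordinatewise limit of
  finite \<open>\<ell>\<^sub>1\<close>-norm, and long truncations of that limit are dominated by \<open>\<nu>\<close> up to the allowed error.\<close>

lemma good_bar: "\<exists>n1\<ge>n0. \<forall>h\<in>H. lev h = k \<longrightarrow> (\<exists>n\<in>{n0..n1}. good h n)"
proof (rule ccontr)
  assume "\<not> ?thesis"
  then have bad0: "\<And>i. n0 \<le> i \<Longrightarrow> \<exists>h\<in>H. lev h = k \<and> (\<forall>n\<in>{n0..i}. \<not> good h n)" by blast
  have "\<forall>i. \<exists>h. h \<in> H \<and> lev h = k \<and> (\<forall>n. n0 \<le> n \<longrightarrow> n \<le> i \<longrightarrow> \<not> good h n)"
  proof
    fix i
    show "\<exists>h. h \<in> H \<and> lev h = k \<and> (\<forall>n. n0 \<le> n \<longrightarrow> n \<le> i \<longrightarrow> \<not> good h n)"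
      using bad0[of "max n0 i"] by fastforce
  qed
  then obtain h where h: "\<And>i. h i \<in> H" "\<And>i. lev (h i) = k"
    and bad: "\<And>i n. n0 \<le> n \<Longrightarrow> n \<le> i \<Longrightarrow> \<not> good (h i) n"
    by metis
  let ?g = "\<lambda>i. rnd (h i)"
  let ?e = "eps k"
  have "norm (?g i j) \<le> real k" for i j
    using sum_abs_rnd_le[OF h(1), of "{j}" i] h(2)[of i] by simp
  then obtain r where r: "strict_mono r" "\<And>j. \<exists>l. (\<lambda>i. ?g (r i) j) \<longlonglongrightarrow> l"
    using function_convergent_subsequence[of UNIV ?g "real k"] by (metis UNIV_I countableI_type)
  then obtain \<zeta> where \<zeta>: "\<And>j. (\<lambda>i. ?g (r i) j) \<longlonglongrightarrow> \<zeta> j" by metis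
  have "(\<Sum>j<M. \<bar>\<zeta> j\<bar>) \<le> real k" for M
  proof (rule LIMSEQ_le_const2)
    show "(\<lambda>i. \<Sum>j<M. \<bar>?g (r i) j\<bar>) \<longlonglongrightarrow> (\<Sum>j<M. \<bar>\<zeta> j\<bar>)" by (intro tendsto_intros \<zeta>)
    show "\<exists>N. \<forall>n\<ge>N. (\<Sum>j<M. \<bar>?g (r n) j\<bar>) \<le> real k"
      using sum_abs_rnd_le[OF h(1)] h(2) by (metis finite_lessThan)
  qed
  then have sum\<zeta>: "summable (\<lambda>j. \<bar>\<zeta> j\<bar>)"
    by (intro summableI_nonneg_bounded[of _ "real k"]) auto
  obtain n1 where n1: "\<And>m. m \<ge> n1 \<Longrightarrow> norm (\<Sum>j. \<bar>\<zeta> (j + m)\<bar>) < ?e / 8"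
    using suminf_exist_split[OF _ sum\<zeta>, of "?e / 8"] eps_pos[of k] by auto
  define n where "n = max n0 n1"
  have tail: "(\<Sum>j\<in>{n..<M}. \<bar>\<zeta> j\<bar>) \<le> ?e / 8" for M
  proof -
    have "(\<Sum>j\<in>{n..<M}. \<bar>\<zeta> j\<bar>) = (\<Sum>j<M - n. \<bar>\<zeta> (j + n)\<bar>)"
    proof (cases "n \<le> M")
      case True
      then show ?thesis
        using sum.shift_bounds_nat_ivl[of "\<lambda>j. \<bar>\<zeta> j\<bar>" 0 n "M - n"] by (simp add: lessThan_atLeast0)
    qed simp
    also have "\<dots> \<le> (\<Sum>j. \<bar>\<zeta> (j + n)\<bar>)"
      by (intro sum_le_suminf summable_ignore_initial_segment sum\<zeta>) auto
    finally show ?thesis using n1[of n] by (simp add: n_def)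
  qed
  have close: "\<exists>i0. \<forall>i\<ge>i0. (\<Sum>j<M. \<bar>?g (r i) j - \<zeta> j\<bar>) \<le> ?e / 8" for M
  proof -
    have "(\<lambda>i. \<Sum>j<M. \<bar>?g (r i) j - \<zeta> j\<bar>) \<longlonglongrightarrow> (\<Sum>j<M. \<bar>\<zeta> j - \<zeta> j\<bar>)" by (intro tendsto_intros \<zeta>)
    then have "\<forall>\<^sub>F i in sequentially. (\<Sum>j<M. \<bar>?g (r i) j - \<zeta> j\<bar>) < ?e / 8"
      by (rule order_tendstoD) (use eps_pos[of k] in auto)
    then show ?thesis unfolding eventually_sequentially by (meson less_imp_le)
  qed
  \<comment> \<open>The length \<open>n\<close> is fixed before \<open>y\<close>; only
    \<open>M\<close> and \<open>i\<close> depend on \<open>y\<close> and \<open>\<kappa>\<close>.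
    The error \<open>?e / 2\<close> consists of 1/8 for the tail of \<open>\<zeta>\<close>, 1/8 for
    the distance to \<open>\<zeta>\<close> and 1/4 for rounding; \<open>\<kappa>\<close> absorbs the
    pairing beyond \<open>M\<close>.\<close>
  have lim: "(\<Sum>j<n. \<zeta> j * A y j) \<le> \<nu> y + ?e / 2 * (c * norm y)" if y: "y \<in> Y" for y
  proof (rule field_le_epsilon)
    fix \<kappa> :: real assume "\<kappa> > 0"
    then obtain M0 where M0: "\<And>j. j \<ge> M0 \<Longrightarrow> \<bar>A y j\<bar> < \<kappa> / (real k + 1)"
      using null[OF y] unfolding lim_sequentially
      by (metis dist_0_norm dist_commute divide_pos_pos of_nat_0_le_iff add_nonneg_pos zero_less_one real_norm_def)
    define M where "M = max n M0"
    obtain i where i: "(\<Sum>j<M. \<bar>?g (r i) j - \<zeta> j\<bar>) \<le> ?e / 8" using close[of M] by blast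
    let ?h = "h (r i)"
    let ?s = "c * norm y"
    have s0: "?s \<ge> 0" using c1 by simp
    have un: "{..<M} = {..<n} \<union> {n..<M}" by (auto simp: M_def)
    have "(\<Sum>j<M. \<zeta> j * A y j) = (\<Sum>j<n. \<zeta> j * A y j) + (\<Sum>j\<in>{n..<M}. \<zeta> j * A y j)"
      by (subst un, rule sum.union_disjoint) auto
    moreover have "\<bar>\<Sum>j\<in>{n..<M}. \<zeta> j * A y j\<bar> \<le> ?e / 8 * ?s"
      using abs_sum_A_le[OF y, of \<zeta> "{n..<M}"] mult_right_mono[OF tail[of M] s0] by linarith
    moreover have "\<bar>\<Sum>j<M. (?g (r i) j - \<zeta> j) * A y j\<bar> \<le> ?e / 8 * ?s"
      using abs_sum_A_le[OF y, of "\<lambda>j. ?g (r i) j - \<zeta> j" "{..<M}"] mult_right_mono[OF i s0] by linarith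
    moreover have "\<bar>\<Sum>j<M. (rnd ?h j - ?h j) * A y j\<bar> \<le> ?e / 4 * ?s"
      using abs_sum_A_le[OF y, of "\<lambda>j. rnd ?h j - ?h j" "{..<M}"]
        mult_right_mono[OF sum_rnd_diff_le[of "{..<M}" ?h] s0] h(2) by simp
    moreover have "\<bar>pair ?h y - (\<Sum>j<M. ?h j * A y j)\<bar> \<le> \<kappa>"
    proof -
      have "\<bar>pair ?h y - (\<Sum>j<M. ?h j * A y j)\<bar> \<le> lev ?h * (\<kappa> / (real k + 1))"
        by (rule pair_tail_le[OF y h(1)]) (use M0 in \<open>auto simp: M_def less_imp_le\<close>)
      also have "\<dots> \<le> (real k + 1) * (\<kappa> / (real k + 1))"
        using \<open>\<kappa> > 0\<close> by (intro mult_right_mono) (auto simp: h(2))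
      also have "\<dots> = \<kappa>" by simp
      finally show ?thesis .
    qed
    moreover have "pair ?h y \<le> \<nu> y" by (intro pair_le y h)
    ultimately show "(\<Sum>j<n. \<zeta> j * A y j) \<le> \<nu> y + ?e / 2 * ?s + \<kappa>"
      unfolding left_diff_distrib sum_subtractf by linarith
  qed
  \<comment> \<open>A further 1/8 leads from \<open>\<zeta>\<close> back to some
    \<open>h (r i)\<close> with \<open>n \<le> r i\<close>, and \<open>n\<close> is then a good
    length where none was supposed to exist.\<close>
  obtain i0 where i0: "\<forall>i\<ge>i0. (\<Sum>j<n. \<bar>?g (r i) j - \<zeta> j\<bar>) \<le> ?e / 8" using close by blast
  define i where "i = max i0 n"
  have ri: "n \<le> r i" using seq_suble[OF r(1), of i] by (simp add: i_def)
  have "good (h (r i)) n" unfolding good_def h(2)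
  proof
    fix y assume y: "y \<in> Y"
    let ?s = "c * norm y"
    have s0: "?s \<ge> 0" using c1 by simp
    have "(\<Sum>j<n. \<bar>?g (r i) j - \<zeta> j\<bar>) \<le> ?e / 8" using i0 by (simp add: i_def)
    then have "(\<Sum>j<n. \<bar>?g (r i) j - \<zeta> j\<bar>) * ?s \<le> ?e / 8 * ?s" using s0 by (rule mult_right_mono)
    then have "\<bar>\<Sum>j<n. (?g (r i) j - \<zeta> j) * A y j\<bar> \<le> ?e / 8 * ?s"
      using abs_sum_A_le[OF y, of "\<lambda>j. ?g (r i) j - \<zeta> j" "{..<n}"] by linarith
    moreover have "0 \<le> ?e * ?s" using eps_pos[of k] s0 by simp
    ultimately show "trunc (h (r i)) n y \<le> \<nu> y + ?e * ?s"
      using lim[OF y] unfolding trunc_def left_diff_distrib sum_subtractf by linarith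
  qed
  then show False using bad[of n "r i"] ri by (simp add: n_def)
qed

lemma eps_antimono: "k \<le> m \<Longrightarrow> eps m \<le> eps k"
  unfolding eps_def
  by (intro frac_le power_decreasing mult_mono) (use c1 C1 in auto)

section \<open>Weights and the size of the functionals \<open>\<Phi>\<close>\<close>

lemma eps_c_norm_le: "y \<in> Y \<Longrightarrow> eps k * (c * norm y) \<le> (1/2) ^ k / 32 * \<nu> y"
proof -
  assume y: "y \<in> Y"
  have "eps k * (c * norm y) \<le> eps k * (c * (C * \<nu> y))"
    using norm_le_\<nu>[OF y] eps_pos[of k] c1 by (intro mult_left_mono) auto
  also have "\<dots> = (eps k * c * C) * \<nu> y" by (simp add: mult_ac)
  also have "\<dots> \<le> (1/2) ^ k / 32 * \<nu> y"
    using eps_c_le \<nu>_nonneg[OF y] by (rule mult_right_mono)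
  finally show ?thesis .
qed

lemma wt_bounds:
  assumes "h \<in> H"
  shows "(1 + (1/2) ^ lev h) * (1 - (1/2) ^ lev h / 32) \<le> wt h n" "0 \<le> wt h n" "wt h n \<le> 1 + (1/2) ^ lev h"
proof -
  let ?u = "(1/2::real) ^ lev h"
  have u: "0 < ?u" "?u \<le> 1" by (auto simp: power_le_one)
  have "eps (lev h) * (\<Sum>j<n. \<bar>rnd h j\<bar>) \<le> eps (lev h) * real (lev h)"
    using eps_pos[of "lev h"] sum_abs_rnd_le[OF assms] by (intro mult_left_mono) auto
  then have e: "eps (lev h) * (\<Sum>j<n. \<bar>rnd h j\<bar>) \<le> ?u / 32" using eps_k_le order_trans by blast
  have e0: "0 \<le> eps (lev h) * (\<Sum>j<n. \<bar>rnd h j\<bar>)"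
    using eps_pos[of "lev h"] by (intro mult_nonneg_nonneg sum_nonneg) auto
  show "(1 + ?u) * (1 - ?u / 32) \<le> wt h n" unfolding wt_def using e u by (intro mult_left_mono) auto
  show "0 \<le> wt h n" unfolding wt_def using e u by (intro mult_nonneg_nonneg) auto
  show "wt h n \<le> 1 + ?u"
  proof -
    have "wt h n \<le> (1 + ?u) * 1" unfolding wt_def using e0 u by (intro mult_left_mono) auto
    then show ?thesis by simp
  qed
qed

lemma wt_le_2: "h \<in> H \<Longrightarrow> wt h n \<le> 2"
  using wt_bounds(3)[of h n] power_le_one[of "1/2::real" "lev h"] by simp

text \<open>The error allowed in \<open>good\<close> is at most the fraction
  \<open>(1/2)^lev h / 32\<close> of \<open>\<nu> y\<close>. At high levels the bound is close to
  \<open>\<nu> y\<close>, which excludes them near a point where \<open>\<nu>\<close> is attained at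
  a low level.\<close>

lemma \<Phi>_le:
  assumes "(h, n) \<in> I" "y \<in> Y"
  shows "\<Phi> (h, n) y \<le> (1 + (1/2) ^ lev h) * (1 + (1/2) ^ lev h / 32) * \<nu> y"
proof -
  let ?u = "(1/2::real) ^ lev h"
  have h: "h \<in> H" "good h n" using assms(1) by (auto simp: I_def)
  have "trunc h n y \<le> \<nu> y + eps (lev h) * (c * norm y)" using h(2) assms(2) unfolding good_def by blast
  also have "\<dots> \<le> (1 + ?u / 32) * \<nu> y" using eps_c_norm_le[OF assms(2), of "lev h"] by (simp add: algebra_simps)
  finally have "wt h n * trunc h n y \<le> wt h n * ((1 + ?u / 32) * \<nu> y)"
    using wt_bounds(2)[OF h(1)] by (intro mult_left_mono) auto
  also have "\<dots> \<le> (1 + ?u) * ((1 + ?u / 32) * \<nu> y)"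
    using wt_bounds(3)[OF h(1)] \<nu>_nonneg[OF assms(2)] by (intro mult_right_mono) auto
  finally show ?thesis by (simp add: \<Phi>_def mult.assoc)
qed

lemma \<Phi>_le_4:
  assumes "i \<in> I" "y \<in> Y" shows "\<Phi> i y \<le> 4 * \<nu> y"
proof -
  obtain h n where i: "i = (h, n)" by (cases i)
  let ?u = "(1/2::real) ^ lev h"
  have "?u \<le> 1" "0 \<le> ?u" by (auto simp: power_le_one)
  then have "(1 + ?u) * (1 + ?u / 32) \<le> 2 * 2" by (intro mult_mono) linarith+
  then have "(1 + ?u) * (1 + ?u / 32) * \<nu> y \<le> 4 * \<nu> y" using \<nu>_nonneg[OF assms(2)] by (intro mult_right_mono) auto
  then show ?thesis using \<Phi>_le[of h n y] assms i by simp
qed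

lemma I_nonempty: "I \<noteq> {}"
  using H_nonempty ex_close good_if_close(1) by (fastforce simp: I_def)

lemma bdd_above_\<Phi>: "y \<in> Y \<Longrightarrow> bdd_above ((\<lambda>i. \<Phi> i y) ` I)"
  using \<Phi>_le_4 by (intro bdd_aboveI[of _ "4 * \<nu> y"]) auto

lemma \<Phi>_le_N: "y \<in> Y \<Longrightarrow> i \<in> I \<Longrightarrow> \<Phi> i y \<le> N y"
  unfolding N_def by (rule cSUP_upper[OF _ bdd_above_\<Phi>])

lemma N_leI: "(\<And>i. i \<in> I \<Longrightarrow> \<Phi> i y \<le> b) \<Longrightarrow> N y \<le> b"
  unfolding N_def by (rule cSUP_least[OF I_nonempty])

lemma lin_\<Phi>: "lin_on Y (\<Phi> i)"
  unfolding lin_on_def \<Phi>_def trunc_def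
  by (auto simp: A_add A_scale distrib_left sum.distrib sum_distrib_left mult_ac)

text \<open>Rounding is odd and \<open>H\<close> is symmetric. Closure under negation is what gives
  \<open>N\<close> its absolute homogeneity.\<close>

lemma \<Phi>_uminus:
  assumes "i \<in> I" shows "\<exists>i'\<in>I. \<forall>y\<in>Y. \<Phi> i' y = - \<Phi> i y"
proof -
  obtain h n where i: "i = (h, n)" by (cases i)
  have h: "h \<in> H" "good h n" using assms i by (auto simp: I_def)
  have l: "lev (\<lambda>j. - h j) = lev h" by (simp add: lev_def)
  have t: "trunc (\<lambda>j. - h j) n y = - trunc h n y" for y
    by (simp add: trunc_def rnd_uminus sum_negf)
  have A: "A (- y) j = - A y j" if "y \<in> Y" for y j using A_scale[OF that, of "-1" j] by simp
  have p: "pair g (- y) = pair (\<lambda>j. - g j) y" if "y \<in> Y" for g y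
    by (simp add: pair_def A[OF that])
  have "\<nu> (- y) \<le> \<nu> y" if y: "y \<in> Y" for y
    unfolding \<nu>_def[of "- y"] by (rule cSUP_least[OF H_nonempty]) (use p[OF y] pair_le[OF y] sym in auto)
  then have \<nu>: "\<nu> (- y) \<le> \<nu> y" if "y \<in> Y" for y using that by blast
  have "good (\<lambda>j. - h j) n" unfolding good_def l
  proof
    fix y assume y: "y \<in> Y"
    have my: "- y \<in> Y" using y Y by (simp add: subspace_neg)
    have "trunc (\<lambda>j. - h j) n y = trunc h n (- y)"
      unfolding t by (simp add: trunc_def A[OF y] sum_negf)
    also have "\<dots> \<le> \<nu> (- y) + eps (lev h) * (c * norm (- y))" using h(2) my unfolding good_def by blast
    finally show "trunc (\<lambda>j. - h j) n y \<le> \<nu> y + eps (lev h) * (c * norm y)" using \<nu>[OF y] by simp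
  qed
  then have "(\<lambda>j. - h j, n) \<in> I" using sym h by (auto simp: I_def)
  moreover have "\<Phi> (\<lambda>j. - h j, n) y = - \<Phi> i y" for y
    by (simp add: \<Phi>_def i t wt_def l rnd_uminus)
  ultimately show ?thesis by blast
qed

text \<open>The length depends on \<open>h\<close> alone and not on \<open>y\<close>, so one
  functional serves a whole neighbourhood. The premise keeps the factor
  \<open>pair h y - ...\<close> nonnegative when inequalities are multiplied.\<close>

lemma ex_\<Phi>_ge:
  assumes "h \<in> H"
  shows "\<exists>n. (h, n) \<in> I \<and> (\<forall>y\<in>Y. (1/2) ^ lev h / 32 * \<nu> y \<le> pair h y \<longrightarrow>
    (1 + (1/2) ^ lev h) * (1 - (1/2) ^ lev h / 32) * (pair h y - (1/2) ^ lev h / 32 * \<nu> y) \<le> \<Phi> (h, n) y)"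
proof -
  let ?u = "(1/2::real) ^ lev h"
  obtain n where n: "(\<Sum>j. \<bar>h (j + n)\<bar>) \<le> eps (lev h) / 4" using ex_close[OF assms] by blast
  have "(1 + ?u) * (1 - ?u / 32) * (pair h y - ?u / 32 * \<nu> y) \<le> \<Phi> (h, n) y"
    if y: "y \<in> Y" and le: "?u / 32 * \<nu> y \<le> pair h y" for y
  proof -
    have "pair h y - ?u / 32 * \<nu> y \<le> trunc h n y"
      using good_if_close(2)[OF assms n y] eps_c_norm_le[OF y, of "lev h"] by linarith
    then have "(1 + ?u) * (1 - ?u / 32) * (pair h y - ?u / 32 * \<nu> y) \<le> wt h n * trunc h n y"
      using le wt_bounds[OF assms] by (intro mult_mono) auto
    then show ?thesis by (simp add: \<Phi>_def)
  qed
  then show ?thesis using good_if_close(1)[OF assms n] assms by (auto simp: I_def)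
qed

text \<open>With \<open>u = (1/2)^m\<close>, the value \<open>(1 + 2/3 * u) * \<nu>y\<close>
  separates level \<open>m\<close> from the higher levels, whose weights are at most
  \<open>1 + u/2\<close>. The factors with \<open>u/32\<close> absorb rounding, the penalty in the
  weight and a small move away from the point.\<close>

lemma weight_gap:
  fixes u \<nu>y :: real
  assumes "0 \<le> u" "u \<le> 1" "0 \<le> \<nu>y"
  shows "(1 + 2/3 * u) * \<nu>y \<le> (1 + u) * (1 - u/32) * ((1 - u/32) * \<nu>y - u/32 * ((1 + u/32) * \<nu>y))"
    and "(1 + u/2) * (1 + u/2/32) * ((1 + u/32) * \<nu>y) \<le> (1 + 2/3 * u) * \<nu>y"
proof -
  have uu: "0 \<le> u * u" "u * u \<le> u" using assms mult_right_mono[of u 1 u] by auto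
  \<comment> \<open>Here \<open>1 - u/15\<close> is a lower bound for
    \<open>1 - u/32 - u/32 * (1 + u/32)\<close>, the last factor of the goal once
    \<open>\<nu>y\<close> is taken out.\<close>
  have a: "1 - u/8 \<le> (1 - u/32) * (1 - u/15)" using uu assms by (simp add: algebra_simps)
  have "(1 + u) * (1 - u/8) = 1 + 7/8 * u - u * u / 8" by (simp add: field_simps)
  then have "1 + 2/3 * u \<le> (1 + u) * (1 - u/8)" using uu assms by linarith
  also have "\<dots> \<le> (1 + u) * ((1 - u/32) * (1 - u/15))" using a assms by (intro mult_left_mono) auto
  also have "\<dots> \<le> (1 + u) * ((1 - u/32) * (1 - u/32 - u/32 * (1 + u/32)))"
    using uu assms by (intro mult_left_mono) (auto simp: algebra_simps)
  finally have "(1 + 2/3 * u) * \<nu>y \<le> (1 + u) * ((1 - u/32) * (1 - u/32 - u/32 * (1 + u/32))) * \<nu>y"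
    using assms(3) by (rule mult_right_mono)
  then show "(1 + 2/3 * u) * \<nu>y \<le> (1 + u) * (1 - u/32) * ((1 - u/32) * \<nu>y - u/32 * ((1 + u/32) * \<nu>y))"
    by (simp add: algebra_simps)
  have b: "(1 + u/2/32) * (1 + u/32) \<le> 1 + u/16"
    using uu assms by (simp add: algebra_simps)
  have "(1 + u/2) * ((1 + u/2/32) * (1 + u/32)) \<le> (1 + u/2) * (1 + u/16)"
    using b assms by (intro mult_left_mono) auto
  also have "\<dots> = 1 + 9/16 * u + u * u / 32" by (simp add: field_simps)
  also have "\<dots> \<le> 1 + 2/3 * u" using uu assms by linarith
  finally have "(1 + u/2) * ((1 + u/2/32) * (1 + u/32)) * \<nu>y \<le> (1 + 2/3 * u) * \<nu>y"
    using assms(3) by (rule mult_right_mono)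
  then show "(1 + u/2) * (1 + u/2/32) * ((1 + u/32) * \<nu>y) \<le> (1 + 2/3 * u) * \<nu>y" by (simp add: mult.assoc)
qed

text \<open>The level factor of the maximiser \<open>h\<close> exceeds 1 by
  \<open>(1/2)^lev h\<close>, which outweighs the penalty and all approximation errors.\<close>

lemma \<nu>_le_N: "y \<in> Y \<Longrightarrow> \<nu> y \<le> N y"
proof -
  assume y: "y \<in> Y"
  obtain h where h: "h \<in> H" "\<nu> y = pair h y" using \<nu>_attained[OF y] by blast
  let ?u = "(1/2::real) ^ lev h"
  have u: "0 \<le> ?u" "?u \<le> 1" by (auto simp: power_le_one)
  have \<nu>0: "0 \<le> \<nu> y" by (rule \<nu>_nonneg[OF y])
  have le: "?u / 32 * \<nu> y \<le> pair h y" using h(2) \<nu>0 u mult_right_mono[of "?u/32" 1 "\<nu> y"] by simp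
  obtain n where n: "(h, n) \<in> I"
    "(1 + ?u) * (1 - ?u / 32) * (pair h y - ?u / 32 * \<nu> y) \<le> \<Phi> (h, n) y"
    using ex_\<Phi>_ge[OF h(1)] y le by blast
  have "1 * \<nu> y \<le> (1 + 2/3 * ?u) * \<nu> y" using u \<nu>0 by (intro mult_right_mono) auto
  also have "\<dots> \<le> (1 + ?u) * (1 - ?u/32) * ((1 - ?u/32) * \<nu> y - ?u/32 * ((1 + ?u/32) * \<nu> y))"
    by (rule weight_gap(1)[OF u \<nu>0])
  also have "\<dots> \<le> (1 + ?u) * (1 - ?u / 32) * (pair h y - ?u / 32 * \<nu> y)"
  proof -
    have "(1 - ?u/32) * \<nu> y \<le> 1 * \<nu> y" "?u/32 * (1 * \<nu> y) \<le> ?u/32 * ((1 + ?u/32) * \<nu> y)"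
      using u \<nu>0 by (intro mult_right_mono mult_left_mono; simp)+
    then have "(1 - ?u/32) * \<nu> y - ?u/32 * ((1 + ?u/32) * \<nu> y) \<le> pair h y - ?u / 32 * \<nu> y"
      unfolding h(2)[symmetric] mult_1 by (rule diff_mono)
    then show ?thesis using u by (intro mult_left_mono) auto
  qed
  also have "\<dots> \<le> \<Phi> (h, n) y" by (rule n)
  also have "\<dots> \<le> N y" by (rule \<Phi>_le_N[OF y n(1)])
  finally show ?thesis by simp
qed

section \<open>\<open>N\<close> as an equivalent norm\<close>

lemma N_bounds:
  assumes "y \<in> Y" shows "1 / C * norm y \<le> N y" "N y \<le> (4 * C) * norm y"
proof -
  have "1 / C * norm y \<le> \<nu> y" using norm_le_\<nu>[OF assms] C1 by (simp add: pos_divide_le_eq mult.commute)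
  then show "1 / C * norm y \<le> N y" using \<nu>_le_N[OF assms] by linarith
  show "N y \<le> (4 * C) * norm y"
    by (rule N_leI) (use \<Phi>_le_4[OF _ assms] \<nu>_le[OF assms] in force)
qed

lemma norm_on_N: "norm_on Y N"
proof -
  have h: "N (t *\<^sub>R y) \<le> \<bar>t\<bar> * N y" if y: "y \<in> Y" for t y
  proof (rule N_leI)
    fix i assume i: "i \<in> I"
    obtain i' where i': "i' \<in> I" "\<Phi> i' y = - \<Phi> i y" using \<Phi>_uminus[OF i] y by blast
    have "\<Phi> i (t *\<^sub>R y) = t * \<Phi> i y" using lin_\<Phi>[of i] y by (simp add: lin_on_def)
    also have "\<dots> \<le> \<bar>t\<bar> * \<bar>\<Phi> i y\<bar>" by (metis abs_ge_self abs_mult)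
    also have "\<dots> \<le> \<bar>t\<bar> * N y"
      using \<Phi>_le_N[OF y i] \<Phi>_le_N[OF y i'(1)] i'(2) by (intro mult_left_mono) auto
    finally show "\<Phi> i (t *\<^sub>R y) \<le> \<bar>t\<bar> * N y" .
  qed
  have N0: "0 \<le> N y" if "y \<in> Y" for y using \<nu>_nonneg[OF that] \<nu>_le_N[OF that] by simp
  show ?thesis unfolding norm_on_def
  proof (intro conjI ballI allI)
    fix y assume y: "y \<in> Y"
    show "0 \<le> N y" by (rule N0[OF y])
    show "N y = 0 \<longleftrightarrow> y = 0"
    proof
      assume "N y = 0"
      then have "norm y \<le> 0" using N_bounds(1)[OF y] C1 by (simp add: field_simps)
      then show "y = 0" by simp
    next
      assume "y = 0"
      then show "N y = 0" using N_bounds(2)[OF y] N0[OF y] by simp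
    qed
    show "N (y + z) \<le> N y + N z" if z: "z \<in> Y" for z
    proof (rule N_leI)
      fix i assume i: "i \<in> I"
      have "\<Phi> i (y + z) = \<Phi> i y + \<Phi> i z" using lin_\<Phi>[of i] y z by (simp add: lin_on_def)
      then show "\<Phi> i (y + z) \<le> N y + N z" using \<Phi>_le_N[OF y i] \<Phi>_le_N[OF z i] by simp
    qed
    show "N (t *\<^sub>R y) = \<bar>t\<bar> * N y" for t
    proof (cases "t = 0")
      case True
      then show ?thesis using h[OF y, of 0] N0[of 0] Y by (simp add: subspace_0)
    next
      case False
      have "t *\<^sub>R y \<in> Y" using y Y by (simp add: subspace_scale)
      then have "N ((1/t) *\<^sub>R (t *\<^sub>R y)) \<le> \<bar>1/t\<bar> * N (t *\<^sub>R y)" by (rule h)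
      then have "\<bar>t\<bar> * N y \<le> N (t *\<^sub>R y)" using False by (simp add: field_simps abs_divide)
      then show ?thesis using h[OF y, of t] by simp
    qed
  qed
qed

section \<open>Local finiteness of the supremum defining \<open>N\<close>\<close>

lemma finite_rnd: "finite {rnd h j |h. h \<in> H \<and> lev h = k}"
proof -
  define \<theta> where "\<theta> = eps k * (1/2) ^ (j + 3)"
  have "\<theta> > 0" using eps_pos by (simp add: \<theta>_def)
  have "{rnd h j |h. h \<in> H \<and> lev h = k} \<subseteq> (\<lambda>x. \<theta> * x) ` {x \<in> \<int>. \<bar>x\<bar> \<le> real k / \<theta>}"
  proof safe
    fix h assume h: "h \<in> H" "k = lev h"
    let ?x = "sgn (h j) * of_int \<lfloor>\<bar>h j\<bar> / \<theta>\<rfloor>"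
    have r: "rnd h j = \<theta> * ?x" by (simp add: rnd_def Let_def \<theta>_def h(2))
    have "\<bar>rnd h j\<bar> \<le> real k" using sum_abs_rnd_le[OF h(1), of "{j}"] h(2) by simp
    then have "\<bar>?x\<bar> \<le> real k / \<theta>" using \<open>\<theta> > 0\<close> unfolding r by (simp add: abs_mult pos_le_divide_eq mult.commute)
    moreover have "?x \<in> \<int>" by (auto simp: sgn_if)
    ultimately show "rnd h j \<in> (\<lambda>x. \<theta> * x) ` {x \<in> \<int>. \<bar>x\<bar> \<le> real (lev h) / \<theta>}" using r h(2) by blast
  qed
  then show ?thesis using finite_abs_int_segment finite_subset by blast
qed

text \<open>\<open>\<Phi> (h, n)\<close> depends only on the level of \<open>h\<close>, on
  \<open>n\<close> and on the first \<open>n\<close> rounded coordinates, each of which ranges over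
  a finite set here.\<close>

lemma finite_\<Phi>: "finite (\<Phi> ` {(h, n). (h, n) \<in> I \<and> lev h \<le> m \<and> n \<le> b (lev h)})"
proof -
  define G where "G = (\<lambda>(k, n, g) y. (1 + (1/2) ^ k) * (1 - eps k * (\<Sum>j<n. \<bar>g j\<bar>)) * (\<Sum>j<n. g j * A y j))"
  let ?D = "SIGMA k:{..m}. SIGMA n:{..b k}. PiE {..<n} (\<lambda>j. {rnd h j |h. h \<in> H \<and> lev h = k})"
  have "finite ?D" by (intro finite_SigmaI finite_PiE finite_rnd) auto
  moreover have "\<Phi> ` {(h, n). (h, n) \<in> I \<and> lev h \<le> m \<and> n \<le> b (lev h)} \<subseteq> G ` ?D"
  proof clarify
    fix h n assume h: "(h, n) \<in> I" "lev h \<le> m" "n \<le> b (lev h)"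
    have "\<Phi> (h, n) = G (lev h, n, restrict (rnd h) {..<n})"
      by (auto simp: G_def \<Phi>_def wt_def trunc_def fun_eq_iff)
    moreover have "(lev h, n, restrict (rnd h) {..<n}) \<in> ?D" using h by (auto simp: I_def)
    ultimately show "\<Phi> (h, n) \<in> G ` ?D" by blast
  qed
  ultimately show ?thesis by (meson finite_imageI finite_subset)
qed

text \<open>Beyond a coordinate where all \<open>A z j\<close> are tiny, prolonging a truncation costs more through its
  weight than it can gain.\<close>

lemma \<Phi>_shorten:
  assumes h: "h \<in> H" and n: "n' \<le> n" and z: "z \<in> Y"
    and small: "\<And>j. n' \<le> j \<Longrightarrow> \<bar>A z j\<bar> \<le> \<tau>" and \<tau>: "\<tau> \<le> eps (lev h) * a"
    and a: "a \<le> trunc h n' z"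
  shows "\<Phi> (h, n) z \<le> \<Phi> (h, n') z"
proof -
  let ?e = "eps (lev h)"
  define P where "P = (\<Sum>j<n'. \<bar>rnd h j\<bar>)"
  define Q where "Q = (\<Sum>j\<in>{n'..<n}. \<bar>rnd h j\<bar>)"
  define f where "f = (\<Sum>j\<in>{n'..<n}. rnd h j * A z j)"
  have un: "{..<n} = {..<n'} \<union> {n'..<n}" using n by auto
  have PQ: "(\<Sum>j<n. \<bar>rnd h j\<bar>) = P + Q" unfolding P_def Q_def un by (rule sum.union_disjoint) auto
  have t: "trunc h n z = trunc h n' z + f" unfolding trunc_def f_def un by (rule sum.union_disjoint) auto
  have Q0: "0 \<le> P" "0 \<le> Q" by (auto simp: P_def Q_def sum_nonneg)
  have f: "\<bar>f\<bar> \<le> \<tau> * Q"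
  proof -
    have "\<bar>f\<bar> \<le> (\<Sum>j\<in>{n'..<n}. \<bar>rnd h j * A z j\<bar>)" unfolding f_def by (rule sum_abs)
    also have "\<dots> \<le> (\<Sum>j\<in>{n'..<n}. \<tau> * \<bar>rnd h j\<bar>)"
    proof (rule sum_mono)
      fix j assume "j \<in> {n'..<n}"
      then show "\<bar>rnd h j * A z j\<bar> \<le> \<tau> * \<bar>rnd h j\<bar>"
        using mult_right_mono[OF small[of j], of "\<bar>rnd h j\<bar>"] by (simp add: abs_mult mult.commute)
    qed
    finally show ?thesis by (simp add: Q_def sum_distrib_left)
  qed
  have "?e * (P + Q) \<le> ?e * real (lev h)"
    using eps_pos[of "lev h"] sum_abs_rnd_le[OF h, of "{..<n}"] PQ by (intro mult_left_mono) auto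
  then have e1: "?e * (P + Q) \<le> 1"
    using eps_k_le[of "lev h"] power_le_one[of "1/2::real" "lev h"] by linarith
  have e0: "0 \<le> ?e * (P + Q)" using eps_pos[of "lev h"] Q0 by simp
  have "(1 - ?e * (P + Q)) * f \<le> 1 * \<bar>f\<bar>"
  proof -
    have "(1 - ?e * (P + Q)) * f \<le> (1 - ?e * (P + Q)) * \<bar>f\<bar>" using e1 by (intro mult_left_mono) auto
    also have "\<dots> \<le> 1 * \<bar>f\<bar>" using e0 by (intro mult_right_mono) auto
    finally show ?thesis .
  qed
  also have "\<dots> \<le> ?e * a * Q" using f mult_right_mono[OF \<tau> Q0(2)] by simp
  also have "\<dots> \<le> ?e * trunc h n' z * Q"
    using a eps_pos[of "lev h"] Q0 by (intro mult_right_mono mult_left_mono) auto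
  finally have "(1 - ?e * (P + Q)) * (trunc h n' z + f) \<le> (1 - ?e * P) * trunc h n' z"
    by (simp add: algebra_simps)
  then have "(1 + (1/2) ^ lev h) * ((1 - ?e * (P + Q)) * (trunc h n' z + f))
      \<le> (1 + (1/2) ^ lev h) * ((1 - ?e * P) * trunc h n' z)"
    by (intro mult_left_mono) auto
  then show ?thesis by (simp add: \<Phi>_def wt_def PQ t P_def[symmetric] mult.assoc)
qed

text \<open>Let \<open>\<nu> y\<close> be attained at level \<open>m\<close>. Near \<open>y\<close>,
  levels above \<open>m\<close> lose to the functional \<open>(h0, l0)\<close> of the maximiser. A
  long truncation of level at most \<open>m\<close> loses to a shorter good one or, where the
  shorter one has a small value, to \<open>(h0, l0)\<close>. Finitely many functionals
  remain.\<close>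

lemma locally_max_of_linear_N:
  assumes y: "y \<in> Y" "y \<noteq> 0"
  shows "\<exists>\<rho>>0. max_of_linear Y (Y \<inter> ball y \<rho>) N"
proof -
  have \<nu>0: "\<nu> y > 0" using norm_le_\<nu>[OF y(1)] y(2) C1
    by (metis less_le mult_zero_right norm_le_zero_iff \<nu>_nonneg[OF y(1)])
  obtain h0 where h0: "h0 \<in> H" "\<nu> y = pair h0 y" using \<nu>_attained[OF y(1)] by blast
  define m where "m = lev h0"
  define u where "u = (1/2::real) ^ m"
  have u: "0 < u" "u \<le> 1" by (auto simp: u_def power_le_one)
  obtain l0 where l0: "(h0, l0) \<in> I" and l0_ge: "\<And>z. z \<in> Y \<Longrightarrow> u / 32 * \<nu> z \<le> pair h0 z \<Longrightarrow>
    (1 + u) * (1 - u / 32) * (pair h0 z - u / 32 * \<nu> z) \<le> \<Phi> (h0, l0) z"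
    using ex_\<Phi>_ge[OF h0(1)] unfolding m_def[symmetric] u_def[symmetric] by blast
  \<comment> \<open>Small enough for \<open>\<Phi>_shorten\<close> at truncation values of at least
    \<open>\<nu> y / 4\<close>, and at all levels up to \<open>m\<close>, since \<open>eps\<close>
    decreases with the level.\<close>
  define \<tau> where "\<tau> = eps m * (\<nu> y / 4)"
  have \<tau>0: "\<tau> > 0" using eps_pos \<nu>0 by (simp add: \<tau>_def)
  obtain n0 where n0: "\<And>j. j \<ge> n0 \<Longrightarrow> \<bar>A y j\<bar> < \<tau> / 2"
    using null[OF y(1)] \<tau>0 unfolding lim_sequentially by (metis dist_0_norm dist_commute half_gt_zero real_norm_def)
  \<comment> \<open>The window starts at \<open>n0\<close>, beyond which the coordinates of
    \<open>y\<close> are small, so every \<open>h\<close> has a good length to which longer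
    truncations can be cut.\<close>
  have "\<forall>k. \<exists>n1\<ge>n0. \<forall>h\<in>H. lev h = k \<longrightarrow> (\<exists>n\<in>{n0..n1}. good h n)" using good_bar by blast
  then obtain b where b: "\<And>h. h \<in> H \<Longrightarrow> \<exists>n\<in>{n0..b (lev h)}. good h n" by metis
  \<comment> \<open>Within this radius, pairings with \<open>H\<close> grow or drop by at most
    \<open>u / 32 * \<nu> y\<close>, and coordinates move by at most
    \<open>\<tau> / 2\<close>.\<close>
  define \<rho> where "\<rho> = min (u * \<nu> y / 32 / C) (\<tau> / 2 / c)"
  have \<rho>: "\<rho> > 0" "C * \<rho> \<le> u / 32 * \<nu> y" "c * \<rho> \<le> \<tau> / 2"
    using u \<nu>0 \<tau>0 c1 C1 by (auto simp: \<rho>_def min_def field_simps)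
  define L where "L = insert (\<Phi> (h0, l0)) (\<Phi> ` {(h, n). (h, n) \<in> I \<and> lev h \<le> m \<and> n \<le> b (lev h)})"
  have "finite L" unfolding L_def using finite_\<Phi> by auto
  have LI: "\<exists>i\<in>I. l = \<Phi> i" if "l \<in> L" for l using that l0 by (auto simp: L_def)
  have key: "\<exists>l\<in>L. \<Phi> i z \<le> l z" if i: "i \<in> I" and z: "z \<in> Y" "dist y z < \<rho>" for i z
  proof -
    obtain h n where hn: "i = (h, n)" by (cases i)
    have h: "h \<in> H" "good h n" "(h, n) \<in> I" using i hn by (auto simp: I_def)
    have yz: "y - z \<in> Y" "z - y \<in> Y" using y(1) z(1) Y by (auto simp: subspace_diff)
    have d: "norm (y - z) < \<rho>" "norm (z - y) < \<rho>" using z(2) by (auto simp: dist_norm norm_minus_commute)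
    have Cd: "C * norm (z - y) \<le> u / 32 * \<nu> y" "C * norm (y - z) \<le> u / 32 * \<nu> y"
      using \<rho>(2) d mult_left_mono[of _ \<rho> C] C1 by (smt (verit))+
    have \<nu>z: "\<nu> z \<le> (1 + u/32) * \<nu> y"
    proof -
      obtain g where g: "g \<in> H" "\<nu> z = pair g z" using \<nu>_attained[OF z(1)] by blast
      have "pair g z = pair g y + pair g (z - y)" using pair_add[OF y(1) yz(2) g(1)] by simp
      then show ?thesis using pair_le[OF y(1) g(1)] upper[OF yz(2) g(1)] Cd(1) g(2)
        unfolding pair_def by (simp add: algebra_simps)
    qed
    have pz: "(1 - u/32) * \<nu> y \<le> pair h0 z"
    proof -
      have "pair h0 y = pair h0 z + pair h0 (y - z)" using pair_add[OF z(1) yz(1) h0(1)] by simp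
      then show ?thesis using upper[OF yz(1) h0(1)] Cd(2) h0(2)
        unfolding pair_def[of h0 "y - z"] by (simp add: algebra_simps)
    qed
    have base: "(1 + 2/3 * u) * \<nu> y \<le> \<Phi> (h0, l0) z"
    proof -
      have "(1 + 2/3 * u) * \<nu> y \<le> (1 + u) * (1 - u/32) * ((1 - u/32) * \<nu> y - u/32 * ((1 + u/32) * \<nu> y))"
        using u \<nu>0 by (intro weight_gap(1)) auto
      also have "\<dots> \<le> (1 + u) * (1 - u/32) * (pair h0 z - u/32 * \<nu> z)"
        using pz \<nu>z u by (intro mult_left_mono diff_mono) auto
      also have "\<dots> \<le> \<Phi> (h0, l0) z"
      proof (rule l0_ge[OF z(1)])
        have "u / 32 * \<nu> z \<le> 1 / 32 * ((1 + 1/32) * \<nu> y)"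
        proof (intro mult_mono)
          show "\<nu> z \<le> (1 + 1/32) * \<nu> y"
            using \<nu>z u \<nu>0 mult_right_mono[of "1 + u/32" "1 + 1/32" "\<nu> y"] by linarith
        qed (use u \<nu>_nonneg[OF z(1)] in auto)
        also have "\<dots> \<le> (1 - 1/32) * \<nu> y" using \<nu>0 by simp
        also have "\<dots> \<le> (1 - u/32) * \<nu> y" using u \<nu>0 by (intro mult_right_mono) auto
        also have "\<dots> \<le> pair h0 z" by (rule pz)
        finally show "u / 32 * \<nu> z \<le> pair h0 z" .
      qed
      finally show ?thesis .
    qed
    show ?thesis
    proof (cases "lev h \<le> m")
      case False
      let ?v = "(1/2::real) ^ lev h"
      have v: "?v \<le> u / 2"
      proof -
        have "?v \<le> (1/2) ^ Suc m" using False by (intro power_decreasing) auto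
        then show ?thesis by (simp add: u_def)
      qed
      have "\<Phi> (h, n) z \<le> (1 + ?v) * (1 + ?v / 32) * \<nu> z" by (rule \<Phi>_le[OF h(3) z(1)])
      also have "\<dots> \<le> (1 + u/2) * (1 + u/2/32) * ((1 + u/32) * \<nu> y)"
        using v u \<nu>z \<nu>_nonneg[OF z(1)] by (intro mult_mono) auto
      also have "\<dots> \<le> (1 + 2/3 * u) * \<nu> y" using u \<nu>0 by (intro weight_gap(2)) auto
      also have "\<dots> \<le> \<Phi> (h0, l0) z" by (rule base)
      finally show ?thesis using hn by (auto simp: L_def)
    next
      case True
      show ?thesis
      proof (cases "n \<le> b (lev h)")
        case True
        then have "\<Phi> (h, n) \<in> L" using h \<open>lev h \<le> m\<close> by (auto simp: L_def)
        then show ?thesis using hn by blast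
      next
        case False
        obtain n' where n': "n0 \<le> n'" "n' \<le> b (lev h)" "good h n'" using b[OF h(1)] by auto
        then have n'L: "\<Phi> (h, n') \<in> L" using h \<open>lev h \<le> m\<close> by (auto simp: L_def I_def)
        have small: "\<bar>A z j\<bar> \<le> \<tau>" if "n' \<le> j" for j
        proof -
          have "A z j = A y j + A (z - y) j" using A_add[OF y(1) yz(2), of j] by simp
          moreover have "\<bar>A (z - y) j\<bar> \<le> c * norm (z - y)" by (rule bound[OF yz(2)])
          moreover have "c * norm (z - y) \<le> c * \<rho>" using d c1 by (intro mult_left_mono) auto
          moreover have "\<bar>A y j\<bar> < \<tau> / 2" using n0 n'(1) that by simp
          ultimately show ?thesis using \<rho>(3) by linarith
        qed
        show ?thesis
        proof (cases "\<nu> y / 4 \<le> trunc h n' z")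
          case True
          have "\<tau> \<le> eps (lev h) * (\<nu> y / 4)"
            unfolding \<tau>_def using eps_antimono[OF \<open>lev h \<le> m\<close>] \<nu>0 by (intro mult_right_mono) auto
          then have "\<Phi> (h, n) z \<le> \<Phi> (h, n') z"
            using \<Phi>_shorten[OF h(1) _ z(1) small _ True] n'(2) False by simp
          then show ?thesis using hn n'L by blast
        next
          \<comment> \<open>Extending from \<open>n'\<close> to \<open>n\<close> adds at most
            \<open>\<nu> y / 128\<close>, so the value stays at most \<open>\<nu> y / 3\<close>. As
            weights are at most 2, the product is at most \<open>2/3 * \<nu> y\<close>, below the
            value of \<open>(h0, l0)\<close>.\<close>
          case small': False
          have "trunc h n z - trunc h n' z = (\<Sum>j\<in>{n'..<n}. rnd h j * A z j)"
            using sum_diff_nat_ivl[of 0 n' n "\<lambda>j. rnd h j * A z j"] n'(2) False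
            by (simp add: trunc_def lessThan_atLeast0)
          also have "\<dots> \<le> (\<Sum>j\<in>{n'..<n}. \<bar>rnd h j\<bar> * \<tau>)"
          proof (rule sum_mono)
            fix j assume "j \<in> {n'..<n}"
            then show "rnd h j * A z j \<le> \<bar>rnd h j\<bar> * \<tau>"
              using mult_left_mono[OF small[of j], of "\<bar>rnd h j\<bar>"] abs_ge_self[of "rnd h j * A z j"]
              by (simp add: abs_mult)
          qed
          also have "\<dots> = (\<Sum>j\<in>{n'..<n}. \<bar>rnd h j\<bar>) * \<tau>" by (simp add: sum_distrib_right)
          also have "\<dots> \<le> real m * \<tau>"
            using sum_abs_rnd_le[OF h(1), of "{n'..<n}"] \<open>lev h \<le> m\<close> \<tau>0 by (intro mult_right_mono) auto
          also have "\<dots> = (eps m * real m) * (\<nu> y / 4)" by (simp add: \<tau>_def)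
          also have "\<dots> \<le> 1/32 * (\<nu> y / 4)"
            using eps_k_le[of m] u \<nu>0 unfolding u_def by (intro mult_right_mono) auto
          finally have "trunc h n z \<le> \<nu> y / 3" using small' \<nu>0 by linarith
          then have "wt h n * trunc h n z \<le> wt h n * (\<nu> y / 3)"
            using wt_bounds(2)[OF h(1)] by (intro mult_left_mono) auto
          also have "\<dots> \<le> 2 * (\<nu> y / 3)" using wt_le_2[OF h(1)] \<nu>0 by (intro mult_right_mono) auto
          also have "\<dots> \<le> (1 + 2/3 * u) * \<nu> y" using u \<nu>0 by (simp add: algebra_simps)
          also have "\<dots> \<le> \<Phi> (h0, l0) z" by (rule base)
          finally show ?thesis using hn by (auto simp: L_def \<Phi>_def)
        qed
      qed
    qed
  qed
  have "max_of_linear Y (Y \<inter> ball y \<rho>) N" unfolding max_of_linear_def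
  proof (intro exI[of _ L] conjI ballI)
    show "finite L" by fact
    show "lin_on Y l" if "l \<in> L" for l using LI[OF that] lin_\<Phi> by auto
    show le: "l z \<le> N z" if "l \<in> L" "z \<in> Y \<inter> ball y \<rho>" for l z
      using LI[OF that(1)] \<Phi>_le_N that(2) by auto
    show "\<exists>l\<in>L. N z = l z" if z: "z \<in> Y \<inter> ball y \<rho>" for z
    proof -
      have ne: "(\<lambda>l. l z) ` L \<noteq> {}" "finite ((\<lambda>l. l z) ` L)" using \<open>finite L\<close> by (auto simp: L_def)
      have "Max ((\<lambda>l. l z) ` L) \<in> (\<lambda>l. l z) ` L" using Max_in ne by blast
      then obtain l where l: "l \<in> L" "l z = Max ((\<lambda>l. l z) ` L)" by force
      have "N z \<le> l z"
      proof (rule N_leI)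
        fix i assume "i \<in> I"
        then obtain l' where "l' \<in> L" "\<Phi> i z \<le> l' z" using key[of i z] z by auto
        moreover have "l' z \<le> l z" unfolding l(2) using ne \<open>l' \<in> L\<close> by (intro Max_ge) auto
        ultimately show "\<Phi> i z \<le> l z" by simp
      qed
      then show ?thesis using le[OF l(1) z] l(1) by (intro bexI[of _ l]) auto
    qed
  qed
  then show ?thesis using \<rho>(1) by blast
qed

theorem iso_polyhedral_Y:
  assumes "\<not> finite_dim_subspace Y"
  shows "iso_polyhedral Y"
  unfolding iso_polyhedral_def
proof (intro exI conjI)
  show "norm_on Y N" by (rule norm_on_N)
  show "0 < 1 / C" "0 < 4 * C" using C1 by auto
  show "\<forall>y\<in>Y. 1 / C * norm y \<le> N y \<and> N y \<le> (4 * C) * norm y" using N_bounds by blast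
  show "polyhedral_under Y N" unfolding polyhedral_under_def
  proof (intro conjI allI impI)
    show "\<not> finite_dim_subspace Y" by fact
    fix F assume F: "subspace F \<and> F \<subseteq> Y \<and> finite_dim_subspace F"
    show "finite {p. p extreme_point_of {y \<in> F. N y \<le> 1}}"
    proof (rule polyhedral_under_locally_max_of_linear[OF Y norm_on_N])
      show "0 < 1 / C" using C1 by simp
    qed (use F N_bounds locally_max_of_linear_N in auto)
  qed
qed

end

section \<open>Basic sequences\<close>

text \<open>Zabreiko's lemma: by Baire some sublevel set of \<open>p\<close> is somewhere dense, hence dense near \<open>0\<close>;
  successive approximation and countable subadditivity remove the closure.\<close>

lemma countably_subadditive_bounded:
  fixes Y :: "'a::banach set" and p :: "'a \<Rightarrow> real"
  assumes Y: "subspace Y" "closed Y"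
    and nonneg: "\<And>y. y \<in> Y \<Longrightarrow> 0 \<le> p y"
    and add: "\<And>y z. y \<in> Y \<Longrightarrow> z \<in> Y \<Longrightarrow> p (y + z) \<le> p y + p z"
    and scale: "\<And>y t. y \<in> Y \<Longrightarrow> p (t *\<^sub>R y) = \<bar>t\<bar> * p y"
    and sub: "\<And>y s. (\<And>i. y i \<in> Y) \<Longrightarrow> y sums s \<Longrightarrow> summable (\<lambda>i. p (y i)) \<Longrightarrow> p s \<le> (\<Sum>i. p (y i))"
  shows "\<exists>K\<ge>0. \<forall>y\<in>Y. p y \<le> K * norm y"
proof -
  define V where "V k = {y \<in> Y. p y \<le> real k}" for k :: nat
  let ?X = "top_of_set Y"
  have "\<exists>k. ?X interior_of (closure (V k)) \<noteq> {}"
  proof (rule ccontr)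
    assume "\<not> ?thesis"
    then have e: "?X interior_of (closure (V k)) = {}" for k by blast
    have VY: "closure (V k) \<subseteq> Y" for k using Y(2) by (intro closure_minimal) (auto simp: V_def)
    have "?X interior_of \<Union>(range (\<lambda>k. closure (V k))) = {}"
    proof (rule Baire_category_alt)
      show "completely_metrizable_space ?X \<or> locally_compact_space ?X \<and> regular_space ?X"
        using completely_metrizable_space_closedin[OF completely_metrizable_space_euclidean] Y(2) by auto
      show "closedin ?X T \<and> ?X interior_of T = {}" if "T \<in> range (\<lambda>k. closure (V k))" for T
        using that e VY closed_subset[OF VY closed_closure] by blast
      show "countable (range (\<lambda>k. closure (V k)))" by simp
    qed
    moreover have "\<Union>(range (\<lambda>k. closure (V k))) = Y"
    proof
      show "Y \<subseteq> \<Union>(range (\<lambda>k. closure (V k)))"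
      proof
        fix y assume y: "y \<in> Y"
        obtain k :: nat where "p y \<le> real k" using real_arch_simple by blast
        then have "y \<in> V k" using y by (simp add: V_def)
        then show "y \<in> \<Union>(range (\<lambda>k. closure (V k)))" using closure_subset by blast
      qed
    qed (use VY in blast)
    ultimately have "?X interior_of Y = {}" by simp
    moreover have "?X interior_of Y = Y" by (metis interior_of_topspace topspace_euclidean_subtopology)
    ultimately show False using subspace_0[OF Y(1)] by simp
  qed
  then obtain k y0 where "y0 \<in> ?X interior_of (closure (V k))" by blast
  then obtain T where T: "openin ?X T" "y0 \<in> T" "T \<subseteq> closure (V k)" by (auto simp: interior_of_def)
  then obtain r where r: "r > 0" "\<And>z. z \<in> Y \<Longrightarrow> dist z y0 < r \<Longrightarrow> z \<in> closure (V k)"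
    unfolding openin_euclidean_subtopology_iff by blast
  have y0: "y0 \<in> Y" using T openin_subset by fastforce
  have dense: "\<exists>v\<in>Y. p v \<le> real k * t \<and> norm (z - v) < e"
    if z: "z \<in> Y" "norm z < r * t" and t: "t > 0" and e: "e > 0" for z and t e :: real
  proof -
    \<comment> \<open>The centre \<open>y0\<close> cancels: \<open>z'\<close> is half the difference
      of \<open>y0 + z'\<close> and \<open>y0 - z'\<close>, both of which are approximated from
      \<open>V k\<close>.\<close>
    define z' where "z' = (1/t) *\<^sub>R z"
    have z': "z' \<in> Y" "norm z' < r" using z t Y(1) by (auto simp: z'_def subspace_scale field_simps)
    have "y0 + z' \<in> closure (V k)" "y0 - z' \<in> closure (V k)"
      using z' y0 Y(1) by (auto intro!: r(2) simp: subspace_add subspace_diff dist_norm)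
    moreover have "e / t > 0" using e t by simp
    ultimately obtain a b where a: "a \<in> V k" "dist a (y0 + z') < e / t" and b: "b \<in> V k" "dist b (y0 - z') < e / t"
      by (meson closure_approachable)
    have ab: "a \<in> Y" "b \<in> Y" "p a \<le> k" "p b \<le> k" using a b by (auto simp: V_def)
    let ?v = "(t/2) *\<^sub>R (a - b)"
    have "a - b \<in> Y" using ab Y(1) by (simp add: subspace_diff)
    moreover have "p (a - b) \<le> 2 * k"
    proof -
      have "(-1) *\<^sub>R b \<in> Y" using ab Y(1) by (metis subspace_scale)
      then show ?thesis using add[OF ab(1), of "(-1) *\<^sub>R b"] scale[OF ab(2), of "-1"] ab by simp
    qed
    ultimately have ab': "a - b \<in> Y" "p (a - b) \<le> 2 * k" by auto
    have "?v \<in> Y" using ab'(1) Y(1) by (rule subspace_scale[rotated])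
    moreover have "p ?v \<le> real k * t"
    proof -
      have "p ?v = t/2 * p (a - b)" using scale[OF ab'(1), of "t/2"] t by simp
      also have "\<dots> \<le> t/2 * (2 * k)" using ab'(2) t by (intro mult_left_mono) auto
      finally show ?thesis by (simp add: mult.commute)
    qed
    moreover have "norm (z - ?v) < e"
    proof -
      have 1: "(y0 + z' - a) - (y0 - z' - b) = 2 *\<^sub>R z' - (a - b)" by (simp add: scaleR_2)
      have 2: "(t/2) *\<^sub>R (2 *\<^sub>R z') = z" using t by (simp add: z'_def)
      have "z - ?v = (t/2) *\<^sub>R ((y0 + z' - a) - (y0 - z' - b))"
        unfolding 1 scaleR_diff_right 2 ..
      then have "norm (z - ?v) = (t/2) * norm ((y0 + z' - a) - (y0 - z' - b))" using t by simp
      moreover have "norm (y0 + z' - a) < e/t" "norm (y0 - z' - b) < e/t"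
        using a(2) b(2) by (simp_all add: dist_norm norm_minus_commute)
      then have "norm ((y0 + z' - a) - (y0 - z' - b)) < e/t + e/t"
        using norm_triangle_ineq4[of "y0 + z' - a" "y0 - z' - b"] by linarith
      then have "(t/2) * norm ((y0 + z' - a) - (y0 - z' - b)) < (t/2) * (e/t + e/t)"
        using t by (intro mult_strict_left_mono) auto
      moreover have "(t/2) * (e/t + e/t) = e" using t by (simp add: field_simps)
      ultimately show ?thesis by linarith
    qed
    ultimately show ?thesis by blast
  qed
  \<comment> \<open>Each remainder is approximated to within half the previous radius by a vector
    whose \<open>p\<close> shrinks geometrically. These vectors telescope to \<open>z\<close>, and
    \<open>sub\<close> adds up their bounds to \<open>2 * k\<close>.\<close>
  have small: "p z \<le> 2 * k" if z: "z \<in> Y" "norm z < r" for z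
  proof -
    let ?P = "\<lambda>n x. x \<in> Y \<and> norm x < r * (1/2) ^ n"
    let ?Q = "\<lambda>n x x'. p (x - x') \<le> real k * (1/2) ^ n"
    have "\<exists>f. \<forall>n. (?P n (f n) \<and> (n = 0 \<longrightarrow> f n = z)) \<and> ?Q n (f n) (f (Suc n))"
    proof (rule dependent_nat_choice)
      show "\<exists>x. ?P 0 x \<and> (0 = 0 \<longrightarrow> x = z)" using z by simp
      fix x n assume x: "?P n x \<and> (n = 0 \<longrightarrow> x = z)"
      obtain v where v: "v \<in> Y" "p v \<le> real k * (1/2) ^ n" "norm (x - v) < r * (1/2) ^ Suc n"
        using dense[of x "(1/2) ^ n" "r * (1/2) ^ Suc n"] x r(1) by auto
      then show "\<exists>y. (?P (Suc n) y \<and> (Suc n = 0 \<longrightarrow> y = z)) \<and> ?Q n x y"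
        using x Y(1) by (intro exI[of _ "x - v"]) (auto simp: subspace_diff)
    qed
    then obtain f where f: "\<And>n. f n \<in> Y" "\<And>n. norm (f n) < r * (1/2) ^ n" "f 0 = z"
      "\<And>n. p (f n - f (Suc n)) \<le> real k * (1/2) ^ n" by metis
    have "(\<lambda>n. r * (1/2::real) ^ n) \<longlonglongrightarrow> r * 0" by (intro tendsto_intros) auto
    then have "f \<longlonglongrightarrow> 0"
      using f(2) by (intro Lim_null_comparison[of f "\<lambda>n. r * (1/2) ^ n"]) (auto simp: less_imp_le)
    then have s: "(\<lambda>n. f n - f (Suc n)) sums z" using telescope_sums'[of f 0] f(3) by simp
    have g: "(\<lambda>n. real k * (1/2::real) ^ n) sums (real k * 2)"
      using geometric_sums[of "1/2::real"] by (intro sums_mult) simp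
    have d: "f n - f (Suc n) \<in> Y" for n by (rule subspace_diff[OF Y(1) f(1) f(1)])
    have sm: "summable (\<lambda>n. p (f n - f (Suc n)))"
      by (rule summable_comparison_test'[OF sums_summable[OF g], of 0]) (simp add: f(4) nonneg[OF d])
    have "p z \<le> (\<Sum>n. p (f n - f (Suc n)))" by (rule sub[OF d s sm])
    also have "\<dots> \<le> (\<Sum>n. real k * (1/2::real) ^ n)" by (rule suminf_le[OF f(4) sm sums_summable[OF g]])
    also have "\<dots> = real k * 2" using sums_unique[OF g] by simp
    finally show ?thesis by simp
  qed
  have "p y \<le> (4 * real k / r) * norm y" if y: "y \<in> Y" for y
  proof (cases "y = 0")
    case True
    then show ?thesis using scale[OF y, of 0] by simp
  next
    case False
    let ?t = "r / (2 * norm y)"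
    have t: "?t > 0" using False r(1) by simp
    have "?t *\<^sub>R y \<in> Y" "norm (?t *\<^sub>R y) < r" using y Y(1) False r(1) by (auto simp: subspace_scale)
    then have "?t * p y \<le> 2 * k"
      using small[of "?t *\<^sub>R y"] scale[OF y, of ?t] unfolding abs_of_pos[OF t] by linarith
    then have "(2 * norm y / r) * (?t * p y) \<le> (2 * norm y / r) * (2 * k)"
      using r(1) by (intro mult_left_mono) auto
    then show ?thesis using False r(1) by (simp add: mult_ac)
  qed
  moreover have "4 * real k / r \<ge> 0" using r(1) by simp
  ultimately show ?thesis by blast
qed

section \<open>Coefficient functionals and the basis constant\<close>

definition coef :: "(nat \<Rightarrow> 'a::real_normed_vector) \<Rightarrow> 'a \<Rightarrow> nat \<Rightarrow> real" where
  "coef xs y = (THE a. (\<lambda>n. a n *\<^sub>R xs n) sums y)"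

lemma coef_sums:
  assumes "basic_sequence xs" "y \<in> closure (span (range xs))"
  shows "(\<lambda>n. coef xs y n *\<^sub>R xs n) sums y"
  using theI'[of "\<lambda>a. (\<lambda>n. a n *\<^sub>R xs n) sums y"] assms
  unfolding basic_sequence_def coef_def by blast

lemma coef_eqI:
  assumes "basic_sequence xs" "y \<in> closure (span (range xs))" "(\<lambda>n. a n *\<^sub>R xs n) sums y"
  shows "coef xs y = a"
  using assms coef_sums[OF assms(1,2)] unfolding basic_sequence_def by blast

lemma subspace_closure_span:
  fixes S :: "'a::real_normed_vector set"
  shows "subspace (closure (span S))"
  unfolding subspace_def
proof (intro conjI ballI allI)
  show "0 \<in> closure (span S)" using closure_subset span_zero by blast
  fix x assume "x \<in> closure (span S)"
  then obtain f where f: "\<And>n. f n \<in> span S" "f \<longlonglongrightarrow> x" by (auto simp: closure_sequential)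
  show "c *\<^sub>R x \<in> closure (span S)" for c
    unfolding closure_sequential
    by (intro exI[of _ "\<lambda>n. c *\<^sub>R f n"] conjI allI span_scale f tendsto_scaleR tendsto_const)
  fix y assume "y \<in> closure (span S)"
  then obtain g where g: "\<And>n. g n \<in> span S" "g \<longlonglongrightarrow> y" by (auto simp: closure_sequential)
  show "x + y \<in> closure (span S)"
    unfolding closure_sequential
    by (intro exI[of _ "\<lambda>n. f n + g n"] conjI allI span_add f g tendsto_add)
qed

lemma coef_add:
  assumes "basic_sequence xs" "y \<in> closure (span (range xs))" "z \<in> closure (span (range xs))"
  shows "coef xs (y + z) = (\<lambda>n. coef xs y n + coef xs z n)"
proof (rule coef_eqI[OF assms(1)])
  show "y + z \<in> closure (span (range xs))" using assms subspace_closure_span subspace_add by blast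
  show "(\<lambda>n. (coef xs y n + coef xs z n) *\<^sub>R xs n) sums (y + z)"
    unfolding scaleR_add_left by (intro sums_add coef_sums assms)
qed

lemma coef_scale:
  assumes "basic_sequence xs" "y \<in> closure (span (range xs))"
  shows "coef xs (t *\<^sub>R y) = (\<lambda>n. t * coef xs y n)"
proof (rule coef_eqI[OF assms(1)])
  show "t *\<^sub>R y \<in> closure (span (range xs))" using assms subspace_closure_span subspace_scale by blast
  show "(\<lambda>n. (t * coef xs y n) *\<^sub>R xs n) sums (t *\<^sub>R y)"
    unfolding scaleR_scaleR[symmetric] by (intro sums_scaleR_right coef_sums assms)
qed

lemma basis_in_closure_span: "xs n \<in> closure (span (range xs))"
  by (meson closure_subset rangeI span_base subsetD)

lemma coef_basis:
  assumes "basic_sequence xs"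
  shows "coef xs (xs m) = (\<lambda>n. if n = m then 1 else 0)"
proof (rule coef_eqI[OF assms basis_in_closure_span])
  have "(\<lambda>n. if n = m then xs n else 0) sums xs m" by (rule sums_single)
  then show "(\<lambda>n. (if n = m then 1 else 0) *\<^sub>R xs n) sums xs m"
    by (rule back_subst[of "\<lambda>f. f sums xs m"]) auto
qed

text \<open>The supremum \<open>p\<close> of the norms of partial sums is countably subadditive: if
  the \<open>y i\<close> sum to \<open>s\<close> with \<open>p (y i)\<close> summable, then the
  coefficientwise sums expand \<open>s\<close>, and by uniqueness they are its coefficients. So
  \<open>countably_subadditive_bounded\<close> applies.\<close>

lemma basis_constant:
  fixes xs :: "nat \<Rightarrow> 'a::banach"
  assumes b: "basic_sequence xs" and \<delta>: "\<delta> > 0" "\<And>n. \<delta> \<le> norm (xs n)"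
  shows "\<exists>K\<ge>0. \<forall>y\<in>closure (span (range xs)). \<forall>n. norm (\<Sum>i<n. coef xs y i *\<^sub>R xs i) \<le> K * norm y"
proof -
  let ?Y = "closure (span (range xs))"
  define S where "S y n = (\<Sum>i<n. coef xs y i *\<^sub>R xs i)" for y n
  define p where "p y = (SUP n. norm (S y n))" for y
  have lim: "S y \<longlonglongrightarrow> y" if "y \<in> ?Y" for y
    using coef_sums[OF b that] unfolding sums_def S_def .
  have Sp: "norm (S y n) \<le> p y" if "y \<in> ?Y" for y n
  proof -
    have "Bseq (S y)" using lim[OF that] convergentI convergent_imp_Bseq by blast
    then have "bdd_above (range (\<lambda>n. norm (S y n)))" unfolding Bseq_def by (auto intro: bdd_aboveI)
    then show ?thesis unfolding p_def by (intro cSUP_upper) auto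
  qed
  have pI: "p y \<le> c" if "\<And>n. norm (S y n) \<le> c" for y c
    unfolding p_def by (rule cSUP_least) (use that in auto)
  have np: "norm y \<le> p y" if "y \<in> ?Y" for y
    using LIMSEQ_le_const2[OF tendsto_norm[OF lim[OF that]]] Sp[OF that] by blast
  have p0: "0 \<le> p y" if "y \<in> ?Y" for y using np[OF that] norm_ge_zero order_trans by blast
  have S_add: "S (y + z) n = S y n + S z n" if "y \<in> ?Y" "z \<in> ?Y" for y z n
    using coef_add[OF b that] by (simp add: S_def scaleR_add_left sum.distrib)
  have S_scale: "S (t *\<^sub>R y) n = t *\<^sub>R S y n" if "y \<in> ?Y" for t y n
    using coef_scale[OF b that] by (simp add: S_def scaleR_sum_right)
  have "\<exists>K\<ge>0. \<forall>y\<in>?Y. p y \<le> K * norm y"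
  proof (rule countably_subadditive_bounded)
    show "subspace ?Y" "closed ?Y" by (auto simp: subspace_closure_span)
    show "p (y + z) \<le> p y + p z" if "y \<in> ?Y" "z \<in> ?Y" for y z
    proof (rule pI)
      fix n
      show "norm (S (y + z) n) \<le> p y + p z"
        using norm_triangle_ineq[of "S y n" "S z n"] Sp[OF that(1), of n] Sp[OF that(2), of n]
        by (simp add: S_add[OF that])
    qed
    have sc: "p (t *\<^sub>R y) \<le> \<bar>t\<bar> * p y" if "y \<in> ?Y" for t y
      by (rule pI) (use Sp[OF that] in \<open>auto simp: S_scale[OF that] mult_left_mono\<close>)
    show "p (t *\<^sub>R y) = \<bar>t\<bar> * p y" if y: "y \<in> ?Y" for t y
    proof (cases "t = 0")
      case True
      then show ?thesis using sc[OF y, of 0] p0[of 0] subspace_0[OF subspace_closure_span] by auto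
    next
      case False
      have "t *\<^sub>R y \<in> ?Y" using y subspace_closure_span subspace_scale by blast
      then have "p ((1/t) *\<^sub>R (t *\<^sub>R y)) \<le> \<bar>1/t\<bar> * p (t *\<^sub>R y)" by (rule sc)
      then have "\<bar>t\<bar> * p y \<le> p (t *\<^sub>R y)" using False by (simp add: field_simps abs_divide)
      then show ?thesis using sc[OF y, of t] by simp
    qed
    fix y s assume y: "\<And>i. y i \<in> ?Y" and s: "y sums s" and sm: "summable (\<lambda>i. p (y i))"
    have sY: "s \<in> ?Y"
    proof -
      have "(\<Sum>i<n. y i) \<in> ?Y" for n by (intro subspace_sum subspace_closure_span y)
      then show ?thesis using s unfolding sums_def by (metis closed_closure closed_sequentially)
    qed
    \<comment> \<open>A term is the difference of two partial sums; the lower bound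
      \<open>\<delta>\<close> turns this into a bound on its coefficient.\<close>
    have cb: "norm (coef xs (y i) n) \<le> (2 / \<delta>) * p (y i)" for i n
    proof -
      have "coef xs (y i) n *\<^sub>R xs n = S (y i) (Suc n) - S (y i) n" by (simp add: S_def)
      then have "\<bar>coef xs (y i) n\<bar> * norm (xs n) \<le> 2 * p (y i)"
        using norm_triangle_ineq4[of "S (y i) (Suc n)" "S (y i) n"] Sp[OF y, of i n] Sp[OF y, of i "Suc n"]
        by (metis (no_types, opaque_lifting) add_mono mult_2 norm_scaleR order_trans)
      then have "\<bar>coef xs (y i) n\<bar> * \<delta> \<le> 2 * p (y i)"
        using mult_left_mono[OF \<delta>(2)[of n], of "\<bar>coef xs (y i) n\<bar>"] by simp
      then show ?thesis using \<delta>(1) by (simp add: field_simps)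
    qed
    have cs: "summable (\<lambda>i. coef xs (y i) n)" for n
      by (rule summable_comparison_test'[OF summable_mult[OF sm, of "2/\<delta>"], of 0]) (use cb in auto)
    define a where "a n = (\<Sum>i. coef xs (y i) n)" for n
    have Ss: "summable (\<lambda>i. norm (S (y i) n))" for n
      by (rule summable_comparison_test'[OF sm, of 0]) (use Sp[OF y] in auto)
    have part: "(\<Sum>n<N. a n *\<^sub>R xs n) = (\<Sum>i. S (y i) N)" for N
    proof -
      have "(\<lambda>i. coef xs (y i) n *\<^sub>R xs n) sums (a n *\<^sub>R xs n)" for n
        unfolding a_def by (intro sums_scaleR_left summable_sums cs)
      then have "(\<lambda>i. \<Sum>n<N. coef xs (y i) n *\<^sub>R xs n) sums (\<Sum>n<N. a n *\<^sub>R xs n)" by (intro sums_sum)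
      then show ?thesis by (simp add: S_def sums_iff)
    qed
    have yn: "summable (\<lambda>i. norm (y i))"
      by (rule summable_comparison_test'[OF sm, of 0]) (use np[OF y] in auto)
    have dom: "norm (norm (S (y i) N - y i)) \<le> 2 * p (y i)" for i N
      using norm_triangle_ineq4[of "S (y i) N" "y i"] Sp[OF y, of i N] np[OF y, of i] by simp
    \<comment> \<open>Tannery's theorem with majorant \<open>2 * p (y i)\<close> carries the
      convergence of the partial sums of each \<open>y i\<close> through the sum over
      \<open>i\<close>.\<close>
    have "(\<lambda>N. norm (S (y i) N - y i)) \<longlonglongrightarrow> 0" for i
      using lim[OF y, of i] by (simp add: LIM_zero tendsto_norm_zero)
    moreover have "\<forall>\<^sub>F (i, N) in at_top \<times>\<^sub>F sequentially. norm (norm (S (y i) N - y i)) \<le> 2 * p (y i)"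
      using dom by (intro always_eventually) auto
    ultimately have "(\<lambda>N. \<Sum>i. norm (S (y i) N - y i)) \<longlonglongrightarrow> (\<Sum>i. 0)"
      using tannerys_theorem[of "\<lambda>i N. norm (S (y i) N - y i)" "\<lambda>i. 0" sequentially "\<lambda>i. 2 * p (y i)"]
        summable_mult[OF sm, of 2] by simp
    then have tz: "(\<lambda>N. \<Sum>i. norm (S (y i) N - y i)) \<longlonglongrightarrow> 0" by simp
    have le: "norm ((\<Sum>n<N. a n *\<^sub>R xs n) - s) \<le> (\<Sum>i. norm (S (y i) N - y i))" for N
    proof -
      have "(\<Sum>n<N. a n *\<^sub>R xs n) - s = (\<Sum>i. S (y i) N - y i)"
        unfolding part sums_unique[OF s]
        by (intro suminf_diff summable_norm_cancel[OF Ss] summable_norm_cancel[OF yn])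
      moreover have "summable (\<lambda>i. norm (S (y i) N - y i))"
        by (rule summable_comparison_test'[OF summable_mult[OF sm, of 2], of 0]) (use dom in auto)
      ultimately show ?thesis using summable_norm by metis
    qed
    have "(\<lambda>N. (\<Sum>n<N. a n *\<^sub>R xs n) - s) \<longlonglongrightarrow> 0"
      by (rule Lim_null_comparison[OF _ tz]) (use le in auto)
    then have "(\<lambda>n. a n *\<^sub>R xs n) sums s" unfolding sums_def by (simp add: LIM_zero_iff)
    then have a: "coef xs s = a" by (rule coef_eqI[OF b sY])
    show "p s \<le> (\<Sum>i. p (y i))"
    proof (rule pI)
      fix n
      have "S s n = (\<Sum>i. S (y i) n)" unfolding part[symmetric] S_def[of s] a ..
      also have "norm \<dots> \<le> (\<Sum>i. norm (S (y i) n))" by (rule summable_norm[OF Ss])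
      also have "\<dots> \<le> (\<Sum>i. p (y i))" by (intro suminf_le Sp y Ss sm)
      finally show "norm (S s n) \<le> (\<Sum>i. p (y i))" .
    qed
  qed (use p0 in auto)
  then show ?thesis using Sp order_trans unfolding S_def by blast
qed

text \<open>A term is the difference of consecutive partial sums. Adding 1 to twice the basis
  constant provides the bound \<open>1 \<le> c\<close> that \<open>c0_model\<close> asks
  for.\<close>

lemma coef_bound:
  fixes xs :: "nat \<Rightarrow> 'a::banach"
  assumes b: "basic_sequence xs" and \<delta>: "\<delta> > 0" "\<And>n. \<delta> \<le> norm (xs n)"
  shows "\<exists>K\<ge>1. \<forall>y\<in>closure (span (range xs)). \<forall>n. \<bar>coef xs y n\<bar> * norm (xs n) \<le> K * norm y"
proof -
  obtain K where K: "K \<ge> 0" "\<And>y n. y \<in> closure (span (range xs)) \<Longrightarrow>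
      norm (\<Sum>i<n. coef xs y i *\<^sub>R xs i) \<le> K * norm y"
    using basis_constant[OF assms] by blast
  have "\<bar>coef xs y n\<bar> * norm (xs n) \<le> (2 * K + 1) * norm y" if y: "y \<in> closure (span (range xs))" for y n
  proof -
    have "coef xs y n *\<^sub>R xs n = (\<Sum>i<Suc n. coef xs y i *\<^sub>R xs i) - (\<Sum>i<n. coef xs y i *\<^sub>R xs i)" by simp
    then have "norm (coef xs y n *\<^sub>R xs n)
        \<le> norm (\<Sum>i<Suc n. coef xs y i *\<^sub>R xs i) + norm (\<Sum>i<n. coef xs y i *\<^sub>R xs i)"
      by (metis norm_triangle_ineq4)
    then have "\<bar>coef xs y n\<bar> * norm (xs n) \<le> K * norm y + K * norm y"
      using K(2)[OF y, of n] K(2)[OF y, of "Suc n"] unfolding norm_scaleR by linarith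
    then show ?thesis unfolding distrib_right using norm_ge_zero[of y] by linarith
  qed
  then show ?thesis using K(1) by (intro exI[of _ "2 * K + 1"]) auto
qed

lemma closure_span_subseq:
  "closure (span (range (xs \<circ> r))) \<subseteq> closure (span (range xs))"
  by (intro closure_mono span_mono) auto

text \<open>Coefficients at indices outside the range of \<open>r\<close> vanish on the span of the
  subsequence and, being continuous by \<open>coef_bound\<close>, on its closure. What is left of
  the expansion is the series along \<open>r\<close>.\<close>

lemma coef_subseq_sums:
  fixes xs :: "nat \<Rightarrow> 'a::banach"
  assumes b: "basic_sequence xs" and \<delta>: "\<delta> > 0" "\<And>n. \<delta> \<le> norm (xs n)"
    and r: "strict_mono r" and y: "y \<in> closure (span (range (xs \<circ> r)))"
  shows "(\<lambda>k. coef xs y (r k) *\<^sub>R xs (r k)) sums y"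
proof -
  let ?Y = "closure (span (range xs))"
  have sub: "z \<in> ?Y" if "z \<in> closure (span (range (xs \<circ> r)))" for z using closure_span_subseq that by blast
  obtain K where K: "K \<ge> 1" "\<And>y n. y \<in> ?Y \<Longrightarrow> \<bar>coef xs y n\<bar> * norm (xs n) \<le> K * norm y"
    using coef_bound[OF b \<delta>] by blast
  have zero: "coef xs y n = 0" if n: "n \<notin> range r" for n
  proof (rule ccontr)
    assume ne: "coef xs y n \<noteq> 0"
    have sp: "z \<in> ?Y \<and> coef xs z n = 0" if "z \<in> span (range (xs \<circ> r))" for z
      using that
    proof (induction rule: span_induct_alt)
      case base
      show ?case using coef_scale[OF b, of 0 0] subspace_0[OF subspace_closure_span, of "range xs"] by simp
    next
      case (step c x z)
      obtain k where x: "x = xs (r k)" using step(1) by auto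
      have z: "z \<in> ?Y" using step(2) by simp
      have cx: "c *\<^sub>R x \<in> ?Y"
        unfolding x by (rule subspace_scale[OF subspace_closure_span basis_in_closure_span])
      then have "coef xs (c *\<^sub>R x + z) n = coef xs (c *\<^sub>R x) n + coef xs z n"
        by (simp add: coef_add[OF b _ z])
      also have "coef xs (c *\<^sub>R x) n = 0"
        unfolding x coef_scale[OF b basis_in_closure_span] coef_basis[OF b] using n by auto
      finally show ?case using step(2) subspace_add[OF subspace_closure_span cx z] by simp
    qed
    have "0 < norm (xs n)" "0 < K" using \<delta>(1) \<delta>(2)[of n] K(1) by linarith+
    then have "\<bar>coef xs y n\<bar> * norm (xs n) / K > 0" using ne by simp
    then obtain z where z: "z \<in> span (range (xs \<circ> r))" "dist z y < \<bar>coef xs y n\<bar> * norm (xs n) / K"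
      using y unfolding closure_approachable by blast
    have zY: "z \<in> ?Y" "y \<in> ?Y" by (rule sub[OF subsetD[OF closure_subset z(1)]], rule sub[OF y])
    have yz: "y - z \<in> ?Y" by (rule subspace_diff[OF subspace_closure_span zY(2,1)])
    have "coef xs (y - z + z) n = coef xs (y - z) n + coef xs z n" using coef_add[OF b yz zY(1)] by simp
    then have "coef xs y n = coef xs (y - z) n" using conjunct2[OF sp[OF z(1)]] by simp
    then have "\<bar>coef xs y n\<bar> * norm (xs n) \<le> K * norm (y - z)" using K(2)[OF yz, of n] by simp
    moreover have "K * norm (y - z) < \<bar>coef xs y n\<bar> * norm (xs n)"
      using z(2) K(1) by (simp add: dist_norm norm_minus_commute[of z] pos_less_divide_eq mult.commute)
    ultimately show False by linarith
  qed
  show ?thesis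
    by (rule iffD2[OF sums_mono_reindex[OF r, of "\<lambda>n. coef xs y n *\<^sub>R xs n"] coef_sums[OF b sub[OF y]]])
      (simp add: zero)
qed

section \<open>Infinite dimension and passage to subsequences\<close>

lemma independent_basic_sequence:
  assumes b: "basic_sequence xs"
  shows "independent (range xs)" "inj xs"
proof -
  show inj: "inj xs"
  proof (rule injI)
    fix m n assume "xs m = xs n"
    then have "coef xs (xs m) m = coef xs (xs n) m" by simp
    then show "m = n" unfolding coef_basis[OF b] by (simp split: if_splits)
  qed
  show "independent (range xs)" unfolding dependent_alt
  proof (rule notI, elim exE conjE bexE)
    fix X v
    assume fin: "finite {x. X x \<noteq> 0}" and sub: "{x. X x \<noteq> 0} \<subseteq> range xs"
      and z: "(\<Sum>x | X x \<noteq> 0. X x *\<^sub>R x) = 0" and v: "X v \<noteq> 0"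
    define T where "T = xs -` {x. X x \<noteq> 0}"
    have T: "finite T" unfolding T_def by (rule finite_vimageI[OF fin inj])
    have img: "xs ` T = {x. X x \<noteq> 0}" unfolding T_def image_vimage_eq using sub by (rule Int_absorb2)
    have "(\<Sum>n\<in>T. X (xs n) *\<^sub>R xs n) = (\<Sum>x\<in>xs ` T. X x *\<^sub>R x)"
      using sum.reindex[OF inj_on_subset[OF inj subset_UNIV], of "\<lambda>x. X x *\<^sub>R x" T] by (simp add: o_def)
    then have "(\<Sum>n\<in>T. X (xs n) *\<^sub>R xs n) = 0" unfolding img z .
    moreover have "(\<lambda>n. X (xs n) *\<^sub>R xs n) sums (\<Sum>n\<in>T. X (xs n) *\<^sub>R xs n)"
      by (rule sums_finite[OF T]) (auto simp: T_def)
    ultimately have s: "(\<lambda>n. X (xs n) *\<^sub>R xs n) sums 0" by simp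
    have 0: "0 \<in> closure (span (range xs))" by (rule subspace_0[OF subspace_closure_span])
    \<comment> \<open>The linear relation is an expansion of 0, and so is the zero sequence.\<close>
    have "coef xs 0 = (\<lambda>n. X (xs n))" by (rule coef_eqI[OF b 0 s])
    moreover have "coef xs 0 = (\<lambda>n. 0)" by (rule coef_eqI[OF b 0]) simp
    ultimately have "X (xs n) = 0" for n by (simp add: fun_eq_iff)
    moreover obtain n where "v = xs n" using v sub by blast
    ultimately show False using v by simp
  qed
qed

lemma not_finite_dim_basic_sequence:
  assumes b: "basic_sequence xs"
  shows "\<not> finite_dim_subspace (closure (span (range xs)))"
proof
  assume "finite_dim_subspace (closure (span (range xs)))"
  then obtain B where B: "finite B" "closure (span (range xs)) = span B"
    unfolding finite_dim_subspace_def by blast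
  have "range xs \<subseteq> span B"
    unfolding B(2)[symmetric] by (rule order_trans[OF span_superset closure_subset])
  then have "finite (range xs)"
    using independent_span_bound[OF B(1) independent_basic_sequence(1)[OF b]] by blast
  then show False
    using finite_imageD[OF _ independent_basic_sequence(2)[OF b]] infinite_UNIV_nat by blast
qed

lemma basic_sequence_subseq:
  fixes xs :: "nat \<Rightarrow> 'a::banach"
  assumes b: "basic_sequence xs" and \<delta>: "\<delta> > 0" "\<And>n. \<delta> \<le> norm (xs n)" and r: "strict_mono r"
  shows "basic_sequence (xs \<circ> r)"
  unfolding basic_sequence_def
proof (intro ballI ex1I)
  fix y assume y: "y \<in> closure (span (range (xs \<circ> r)))"
  show "(\<lambda>k. coef xs y (r k) *\<^sub>R (xs \<circ> r) k) sums y" using coef_subseq_sums[OF b \<delta> r y] by simp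
  fix a assume a: "(\<lambda>k. a k *\<^sub>R (xs \<circ> r) k) sums y"
  have inj: "inj r" using r by (rule strict_mono_imp_inj_on)
  \<comment> \<open>Extension by 0 turns an expansion along \<open>r\<close> into one along
    \<open>xs\<close>, where coefficients are unique.\<close>
  define a' where "a' n = (if n \<in> range r then a (inv r n) else 0)" for n
  have ar: "a' (r k) = a k" for k by (simp add: a'_def inv_f_f[OF inj])
  have "(\<lambda>n. a' n *\<^sub>R xs n) sums y"
  proof (rule iffD1[OF sums_mono_reindex[OF r]])
    show "(\<lambda>k. a' (r k) *\<^sub>R xs (r k)) sums y" using a by (simp add: ar)
  qed (simp add: a'_def)
  then have "coef xs y = a'" by (rule coef_eqI[OF b subsetD[OF closure_span_subseq y]])
  then show "a = (\<lambda>k. coef xs y (r k))" by (simp add: ar)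
qed

section \<open>Choosing the subsequence\<close>

text \<open>Reading \<open>e\<close> as the sequence of its values \<open>e (w j)\<close> turns
  \<open>E\<close> and its negatives into the set \<open>H\<close> of \<open>c0_model\<close>; by
  \<open>exp\<close>, the pairing with \<open>A y\<close> is then \<open>e y\<close> up to
  sign.\<close>

lemma iso_polyhedral_of_expansion:
  fixes Y :: "'a::real_normed_vector set" and w :: "nat \<Rightarrow> 'a" and E :: "('a \<Rightarrow>\<^sub>L real) set"
  assumes Y: "subspace Y" "\<not> finite_dim_subspace Y"
    and lin: "\<And>j. lin_on Y (\<lambda>y. A y j)"
    and c: "1 \<le> c" "\<And>y j. y \<in> Y \<Longrightarrow> \<bar>A y j\<bar> \<le> c * norm y"
    and null: "\<And>y. y \<in> Y \<Longrightarrow> A y \<longlonglongrightarrow> 0"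
    and E: "iso_precisely_norming E"
    and w: "\<And>e. e \<in> E \<Longrightarrow> summable (\<lambda>j. \<bar>blinfun_apply e (w j)\<bar>)"
    and exp: "\<And>e y. e \<in> E \<Longrightarrow> y \<in> Y \<Longrightarrow> (\<lambda>j. A y j * blinfun_apply e (w j)) sums blinfun_apply e y"
  shows "iso_polyhedral Y"
proof -
  note nfd = Y(2)
  obtain C where C: "C \<ge> 1" "\<And>e. e \<in> E \<Longrightarrow> norm e \<le> C"
    and lower: "\<And>x. norm x / C \<le> (SUP e\<in>E. \<bar>blinfun_apply e x\<bar>)"
    and att: "\<And>x. \<exists>e0\<in>E. \<bar>blinfun_apply e0 x\<bar> = (SUP e\<in>E. \<bar>blinfun_apply e x\<bar>)"
    using E unfolding iso_precisely_norming_def by blast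
  have eC: "\<bar>blinfun_apply e x\<bar> \<le> C * norm x" if "e \<in> E" for e x
    using norm_blinfun[of e x] mult_right_mono[OF C(2)[OF that] norm_ge_zero[of x]] by simp
  have eS: "\<bar>blinfun_apply e x\<bar> \<le> (SUP e\<in>E. \<bar>blinfun_apply e x\<bar>)" if "e \<in> E" for e x
    by (rule cSUP_upper[OF that]) (use eC in \<open>auto intro!: bdd_aboveI[of _ "C * norm x"]\<close>)
  define H where "H = {h. \<exists>e\<in>E. \<exists>\<sigma>\<in>{1, -1}. h = (\<lambda>j. \<sigma> * blinfun_apply e (w j))}"
  have pr: "(\<Sum>j. (\<sigma> * blinfun_apply e (w j)) * A y j) = \<sigma> * blinfun_apply e y"
    if "e \<in> E" "y \<in> Y" for e y \<sigma>
    using sums_unique[OF sums_mult[OF exp[OF that], of \<sigma>]] by (simp add: mult_ac)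
  interpret c0_model Y A H c C
  proof
    show "summable (\<lambda>j. \<bar>h j\<bar>)" if "h \<in> H" for h
      using that w by (auto simp: H_def abs_mult)
    show "(\<lambda>j. - h j) \<in> H" if h: "h \<in> H" for h
    proof -
      obtain e \<sigma> where "e \<in> E" "\<sigma> \<in> {1, -1}" "h = (\<lambda>j. \<sigma> * blinfun_apply e (w j))"
        using h unfolding H_def by blast
      then show ?thesis unfolding H_def by (intro CollectI bexI[of _ e] bexI[of _ "- \<sigma>"]) auto
    qed
    fix y assume y: "y \<in> Y"
    have le: "(\<Sum>j. h j * A y j) \<le> (SUP e\<in>E. \<bar>blinfun_apply e y\<bar>) \<and> (\<Sum>j. h j * A y j) \<le> C * norm y"
      if h: "h \<in> H" for h
    proof -
      obtain e \<sigma> where e: "e \<in> E" "\<sigma> \<in> {1, -1}" "h = (\<lambda>j. \<sigma> * blinfun_apply e (w j))"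
        using h unfolding H_def by blast
      have "\<sigma> * blinfun_apply e y \<le> \<bar>blinfun_apply e y\<bar>" using e(2) by auto
      then show ?thesis using pr[OF e(1) y, of \<sigma>] eS[OF e(1), of y] eC[OF e(1), of y] unfolding e(3) by simp
    qed
    show "(\<Sum>j. h j * A y j) \<le> C * norm y" if "h \<in> H" for h using le[OF that] by simp
    obtain e0 where e0: "e0 \<in> E" "\<bar>blinfun_apply e0 y\<bar> = (SUP e\<in>E. \<bar>blinfun_apply e y\<bar>)" using att by blast
    \<comment> \<open>This sign makes the pairing equal to the attained absolute value.\<close>
    define \<sigma> :: real where "\<sigma> = (if blinfun_apply e0 y \<ge> 0 then 1 else -1)"
    let ?h = "\<lambda>j. \<sigma> * blinfun_apply e0 (w j)"
    have h: "?h \<in> H" unfolding H_def using e0(1) by (auto simp: \<sigma>_def)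
    have "(\<Sum>j. ?h j * A y j) = (SUP e\<in>E. \<bar>blinfun_apply e y\<bar>)"
      unfolding pr[OF e0(1) y] e0(2)[symmetric] by (simp add: \<sigma>_def)
    then show "\<exists>h\<in>H. norm y / C \<le> (\<Sum>j. h j * A y j) \<and> (\<forall>g\<in>H. (\<Sum>j. g j * A y j) \<le> (\<Sum>j. h j * A y j))"
      using h lower[of y] le by (intro bexI[of _ ?h]) auto
  qed (use Y lin c null C(1) in auto)
  show ?thesis by (rule iso_polyhedral_Y[OF nfd])
qed

lemma lin_on_coef:
  assumes "basic_sequence xs"
  shows "lin_on (closure (span (range xs))) (\<lambda>y. coef xs y j)"
  unfolding lin_on_def by (simp add: coef_add[OF assms] coef_scale[OF assms])

text \<open>The expansion uses the normalised terms. Up to sign its coordinates are the norms of the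
  terms of a convergent series, hence null, and \<open>coef_bound\<close> bounds them.\<close>

lemma iso_polyhedral_summable:
  fixes xs :: "nat \<Rightarrow> 'a::banach"
  assumes b: "basic_sequence xs" and \<delta>: "\<delta> > 0" "\<And>n. \<delta> \<le> norm (xs n)"
    and E: "iso_precisely_norming E"
    and sm: "\<And>e. e \<in> E \<Longrightarrow> summable (\<lambda>k. \<bar>blinfun_apply e (xs k)\<bar> / norm (xs k))"
  shows "iso_polyhedral (closure (span (range xs)))"
proof -
  let ?Y = "closure (span (range xs))"
  have nz: "norm (xs k) > 0" for k using \<delta>(1) \<delta>(2)[of k] by linarith
  obtain K where K: "K \<ge> 1" "\<And>y n. y \<in> ?Y \<Longrightarrow> \<bar>coef xs y n\<bar> * norm (xs n) \<le> K * norm y"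
    using coef_bound[OF b \<delta>] by blast
  show ?thesis
  proof (rule iso_polyhedral_of_expansion[where A = "\<lambda>y k. coef xs y k * norm (xs k)"
        and w = "\<lambda>k. (1 / norm (xs k)) *\<^sub>R xs k" and c = K and E = E])
    show "subspace ?Y" by (rule subspace_closure_span)
    show "\<not> finite_dim_subspace ?Y" by (rule not_finite_dim_basic_sequence[OF b])
    show "lin_on ?Y (\<lambda>y. coef xs y j * norm (xs j))" for j
      using lin_on_coef[OF b, of j] by (simp add: lin_on_def distrib_right)
    show "\<bar>coef xs y j * norm (xs j)\<bar> \<le> K * norm y" if "y \<in> ?Y" for y j
      using K(2)[OF that, of j] by (simp add: abs_mult)
    show "(\<lambda>k. coef xs y k * norm (xs k)) \<longlonglongrightarrow> 0" if "y \<in> ?Y" for y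
    proof -
      have "(\<lambda>k. coef xs y k *\<^sub>R xs k) \<longlonglongrightarrow> 0"
        by (rule summable_LIMSEQ_zero[OF sums_summable[OF coef_sums[OF b that]]])
      then have "(\<lambda>k. norm (coef xs y k *\<^sub>R xs k)) \<longlonglongrightarrow> 0" by (rule tendsto_norm_zero)
      then show ?thesis by (rule Lim_null_comparison[rotated]) (simp add: abs_mult)
    qed
    show "summable (\<lambda>j. \<bar>blinfun_apply e ((1 / norm (xs j)) *\<^sub>R xs j)\<bar>)" if "e \<in> E" for e
      using sm[OF that] by (simp add: blinfun.scaleR_right abs_mult)
    show "(\<lambda>j. coef xs y j * norm (xs j) * blinfun_apply e ((1 / norm (xs j)) *\<^sub>R xs j)) sums blinfun_apply e y"
      if "e \<in> E" "y \<in> ?Y" for e y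
    proof -
      have "(\<lambda>k. blinfun_apply e (coef xs y k *\<^sub>R xs k)) sums blinfun_apply e y"
        by (rule bounded_linear.sums[OF blinfun.bounded_linear_right coef_sums[OF b that(2)]])
      moreover have "coef xs y j * norm (xs j) * blinfun_apply e ((1 / norm (xs j)) *\<^sub>R xs j)
          = blinfun_apply e (coef xs y j *\<^sub>R xs j)" for j
        using nz[of j] by (simp add: blinfun.scaleR_right)
      ultimately show ?thesis by simp
    qed
  qed (use K(1) E in auto)
qed

section \<open>Scalar sequences of finite variation\<close>

lemma abs_diff_le_variation:
  fixes f :: "nat \<Rightarrow> real"
  assumes "a \<le> b" shows "\<bar>f b - f a\<bar> \<le> (\<Sum>n\<in>{a..<b}. \<bar>f (Suc n) - f n\<bar>)"
  using assms
proof (induction b rule: dec_induct)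
  case (step n)
  then show ?case by (simp add: sum.atLeastLessThan_Suc)
qed simp

lemma summable_blocks:
  fixes v :: "nat \<Rightarrow> real"
  assumes v: "summable v" "\<And>n. 0 \<le> v n" and r: "strict_mono r"
  shows "summable (\<lambda>k. \<Sum>n\<in>{r k..<r (Suc k)}. v n)"
proof (rule summableI_nonneg_bounded)
  show "0 \<le> (\<Sum>n\<in>{r k..<r (Suc k)}. v n)" for k by (simp add: sum_nonneg v(2))
  have "(\<Sum>k<N. \<Sum>n\<in>{r k..<r (Suc k)}. v n) \<le> (\<Sum>n<r N. v n)" for N
  proof (induction N)
    case (Suc N)
    have "r N \<le> r (Suc N)" using r by (simp add: strict_mono_less_eq)
    then have "(\<Sum>n<r (Suc N). v n) = (\<Sum>n<r N. v n) + (\<Sum>n\<in>{r N..<r (Suc N)}. v n)"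
      using sum.atLeastLessThan_concat[of 0 "r N" "r (Suc N)" v] by (simp add: lessThan_atLeast0)
    then show ?case using Suc by simp
  qed (simp add: sum_nonneg v(2))
  then show "(\<Sum>k<N. \<Sum>n\<in>{r k..<r (Suc k)}. v n) \<le> suminf v" for N
    using sum_le_suminf[OF v(1), of "{..<r N}"] v(2) by (meson finite_lessThan order_trans)
qed

lemma Bseq_of_variation:
  fixes f :: "nat \<Rightarrow> real"
  assumes "summable (\<lambda>n. \<bar>f (Suc n) - f n\<bar>)"
  shows "Bseq f"
proof (rule BseqI')
  fix n
  have "\<bar>f n - f 0\<bar> \<le> (\<Sum>i\<in>{0..<n}. \<bar>f (Suc i) - f i\<bar>)" by (rule abs_diff_le_variation) simp
  also have "\<dots> \<le> (\<Sum>i. \<bar>f (Suc i) - f i\<bar>)" by (intro sum_le_suminf assms) auto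
  finally show "norm (f n) \<le> \<bar>f 0\<bar> + (\<Sum>i. \<bar>f (Suc i) - f i\<bar>)" by simp
qed

lemma summable_variation_subseq:
  fixes f :: "nat \<Rightarrow> real"
  assumes "summable (\<lambda>n. \<bar>f (Suc n) - f n\<bar>)" "strict_mono r"
  shows "summable (\<lambda>k. \<bar>f (r (Suc k)) - f (r k)\<bar>)"
proof (rule summable_comparison_test'[OF summable_blocks[OF assms(1) _ assms(2)]])
  show "norm \<bar>f (r (Suc k)) - f (r k)\<bar> \<le> (\<Sum>n\<in>{r k..<r (Suc k)}. \<bar>f (Suc n) - f n\<bar>)" if "0 \<le> k" for k
    using abs_diff_le_variation[of "r k" "r (Suc k)" f] assms(2) by (simp add: strict_mono_less_eq)
qed simp

text \<open>Summation by parts: the coefficients of \<open>y\<close> with respect to the differences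
  \<open>x\<^sub>0, x\<^sub>1 - x\<^sub>0, x\<^sub>2 - x\<^sub>1, \<dots>\<close> are the tails of its coefficient series.\<close>

lemma iso_polyhedral_bounded_sums:
  fixes xs :: "nat \<Rightarrow> 'a::banach"
  assumes b: "basic_sequence xs"
    and E: "iso_precisely_norming E"
    and sm: "\<forall>e\<in>E. summable (\<lambda>n. \<bar>blinfun_apply e (xs (Suc n) - xs n)\<bar>)"
    and s: "\<And>y. y \<in> closure (span (range xs)) \<Longrightarrow> summable (coef xs y)"
    and c: "\<And>y n. y \<in> closure (span (range xs)) \<Longrightarrow> \<bar>\<Sum>k<n. coef xs y k\<bar> \<le> c * norm y"
  shows "iso_polyhedral (closure (span (range xs)))"
proof -
  let ?Y = "closure (span (range xs))"
  define A where "A y j = suminf (coef xs y) - (\<Sum>k<j. coef xs y k)" for y j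
  define w where "w j = (case j of 0 \<Rightarrow> xs 0 | Suc i \<Rightarrow> xs (Suc i) - xs i)" for j
  have null: "A y \<longlonglongrightarrow> 0" if "y \<in> ?Y" for y
    unfolding A_def using tendsto_diff[OF tendsto_const summable_LIMSEQ[OF s[OF that]], of "suminf (coef xs y)"] by simp
  show ?thesis
  proof (rule iso_polyhedral_of_expansion[where A = A and w = w and c = "max 1 (2 * c)" and E = E])
    show "subspace ?Y" by (rule subspace_closure_span)
    show "\<not> finite_dim_subspace ?Y" by (rule not_finite_dim_basic_sequence[OF b])
    show "lin_on ?Y (\<lambda>y. A y j)" for j
      unfolding lin_on_def A_def
      by (auto simp: coef_add[OF b] coef_scale[OF b] suminf_add[OF s s, symmetric] suminf_mult[OF s]
          sum.distrib sum_distrib_left right_diff_distrib)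
    show "\<bar>A y j\<bar> \<le> max 1 (2 * c) * norm y" if y: "y \<in> ?Y" for y j
    proof -
      have "\<bar>suminf (coef xs y)\<bar> \<le> c * norm y"
        by (rule LIMSEQ_le_const2[OF tendsto_rabs[OF summable_LIMSEQ[OF s[OF y]]]]) (use c[OF y] in blast)
      then have "\<bar>A y j\<bar> \<le> 2 * c * norm y" using c[OF y, of j] unfolding A_def by linarith
      also have "\<dots> \<le> max 1 (2 * c) * norm y" by (intro mult_right_mono) auto
      finally show ?thesis .
    qed
    show "summable (\<lambda>j. \<bar>blinfun_apply e (w j)\<bar>)" if "e \<in> E" for e
      by (rule iffD1[OF summable_Suc_iff]) (use bspec[OF sm that] in \<open>simp add: w_def\<close>)
    show "(\<lambda>j. A y j * blinfun_apply e (w j)) sums blinfun_apply e y" if e: "e \<in> E" and y: "y \<in> ?Y" for e y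
    proof -
      let ?f = "\<lambda>n. blinfun_apply e (xs n)"
      \<comment> \<open>Since \<open>w 0 = xs 0\<close>, the first \<open>Suc N\<close> terms in
        \<open>w\<close> match the first \<open>N\<close> terms in \<open>xs\<close> plus a boundary
        term at \<open>xs N\<close>.\<close>
      have id: "(\<Sum>j<Suc N. A y j * blinfun_apply e (w j)) = (\<Sum>k<N. coef xs y k * ?f k) + A y N * ?f N" for N
      proof (induction N)
        case 0
        then show ?case by (simp add: w_def)
      next
        case (Suc N)
        have 1: "coef xs y N = A y N - A y (Suc N)" by (simp add: A_def)
        have 2: "(\<Sum>j<Suc (Suc N). A y j * blinfun_apply e (w j))
            = (\<Sum>k<N. coef xs y k * ?f k) + A y N * ?f N + A y (Suc N) * (?f (Suc N) - ?f N)"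
          unfolding sum.lessThan_Suc[of _ "Suc N"] Suc.IH by (simp add: w_def blinfun.diff_right)
        show ?case unfolding 2 sum.lessThan_Suc[of _ N] 1 by (simp add: algebra_simps)
      qed
      have "(\<lambda>k. coef xs y k * ?f k) sums blinfun_apply e y"
        using bounded_linear.sums[OF blinfun.bounded_linear_right coef_sums[OF b y], of e]
        by (simp add: blinfun.scaleR_right)
      then have 1: "(\<lambda>N. \<Sum>k<N. coef xs y k * ?f k) \<longlonglongrightarrow> blinfun_apply e y" by (simp add: sums_def)
      \<comment> \<open>Finite variation bounds \<open>e\<close> along \<open>xs\<close> and
        \<open>A y\<close> is null, so the boundary term vanishes in the limit.\<close>
      have "Bseq ?f" using bspec[OF sm e] by (intro Bseq_of_variation) (simp add: blinfun.diff_right)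
      then have 2: "(\<lambda>N. A y N * ?f N) \<longlonglongrightarrow> 0"
        using null[OF y] by (metis (no_types) Bfun_def lim_null_mult_right_bounded)
      show ?thesis unfolding sums_def
        by (rule LIMSEQ_imp_Suc) (use tendsto_add[OF 1 2] in \<open>simp only: id add_0_right\<close>)
    qed
  qed (use null E in auto)
qed

section \<open>Extraction of the subsequence in the three cases\<close>

lemma exists_strict_mono:
  assumes "\<And>k n. \<exists>m>n. P k (m::nat)"
  shows "\<exists>r::nat \<Rightarrow> nat. strict_mono r \<and> (\<forall>k. P k (r k))"
proof -
  have "\<exists>f. \<forall>n. P n (f n) \<and> f n < f (Suc n)"
  proof (rule dependent_nat_choice)
    show "\<exists>x. P 0 x" using assms[of 0 0] by blast
    show "\<exists>y. P (Suc n) y \<and> x < y" for x n using assms[where k = "Suc n" and n = x] by blast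
  qed
  then show ?thesis by (auto simp: strict_mono_Suc_iff)
qed

text \<open>Finite variation bounds each \<open>e\<close> along \<open>xs\<close>, so the normalised
  values at indices with norm at least \<open>2 ^ k\<close> are dominated by a geometric
  series.\<close>

lemma iso_polyhedral_subseq_unbounded:
  fixes xs :: "nat \<Rightarrow> 'a::banach"
  assumes b: "basic_sequence xs" and \<delta>: "\<delta> > 0" "\<And>n. \<delta> \<le> norm (xs n)"
    and E: "iso_precisely_norming E"
    and sm: "\<forall>e\<in>E. summable (\<lambda>n. \<bar>blinfun_apply e (xs (Suc n) - xs n)\<bar>)"
    and unb: "\<not> Bseq xs"
  shows "\<exists>r::nat \<Rightarrow> nat. strict_mono r \<and> iso_polyhedral (closure (span (range (xs \<circ> r))))"
proof -
  have "\<exists>m>n. 2 ^ k \<le> norm (xs m)" for k n :: nat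
  proof (rule ccontr)
    assume "\<not> ?thesis"
    then have lt: "norm (xs m) \<le> 2 ^ k" if "m > n" for m using that by (meson less_imp_le not_le)
    have "norm (xs m) \<le> 2 ^ k + (\<Sum>i\<le>n. norm (xs i))" for m
    proof (cases "m \<le> n")
      case True
      then have "norm (xs m) \<le> (\<Sum>i\<le>n. norm (xs i))" by (intro member_le_sum) auto
      then show ?thesis by (simp add: add_increasing)
    next
      case False
      then show ?thesis using lt[of m] by (simp add: add_increasing2 sum_nonneg)
    qed
    then show False using unb BseqI' by blast
  qed
  then obtain r :: "nat \<Rightarrow> nat" where r: "strict_mono r" "\<And>k. 2 ^ k \<le> norm (xs (r k))"
    using exists_strict_mono[of "\<lambda>k m. 2 ^ k \<le> norm (xs m)"] by blast
  have "iso_polyhedral (closure (span (range (xs \<circ> r))))"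
  proof (rule iso_polyhedral_summable[OF basic_sequence_subseq[OF b \<delta> r(1)] \<delta>(1) _ E])
    show "\<delta> \<le> norm ((xs \<circ> r) n)" for n using \<delta>(2) by simp
    fix e assume e: "e \<in> E"
    have "Bseq (\<lambda>n. blinfun_apply e (xs n))"
      using bspec[OF sm e] by (intro Bseq_of_variation) (simp add: blinfun.diff_right)
    then obtain B where B: "B > 0" "\<And>n. \<bar>blinfun_apply e (xs n)\<bar> \<le> B" unfolding Bseq_def by auto
    show "summable (\<lambda>k. \<bar>blinfun_apply e ((xs \<circ> r) k)\<bar> / norm ((xs \<circ> r) k))"
    proof (rule summable_comparison_test')
      show "summable (\<lambda>k. B * (1/2::real) ^ k)" by (intro summable_mult summable_geometric) simp
      fix k
      have "\<bar>blinfun_apply e (xs (r k))\<bar> / norm (xs (r k)) \<le> B / 2 ^ k"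
        by (rule frac_le) (use B r(2)[of k] in auto)
      then show "norm (\<bar>blinfun_apply e ((xs \<circ> r) k)\<bar> / norm ((xs \<circ> r) k)) \<le> B * (1/2) ^ k"
        by (simp add: power_one_over)
    qed
  qed
  then show ?thesis using r(1) by blast
qed

text \<open>The scalar sequences \<open>c\<close> below are those of the form \<open>c n = f (xs n)\<close> with \<open>f\<close> a bounded
  linear functional on the span of \<open>xs\<close>.\<close>

definition functional_values :: "(nat \<Rightarrow> 'a::real_normed_vector) \<Rightarrow> (nat \<Rightarrow> real) \<Rightarrow> real \<Rightarrow> bool" where
  "functional_values xs c C \<longleftrightarrow>
    (\<forall>a J. finite J \<longrightarrow> \<bar>\<Sum>n\<in>J. a n * c n\<bar> \<le> C * norm (\<Sum>n\<in>J. a n *\<^sub>R xs n))"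

lemma functional_valuesD:
  "functional_values xs c C \<Longrightarrow> finite J \<Longrightarrow> \<bar>\<Sum>n\<in>J. a n * c n\<bar> \<le> C * norm (\<Sum>n\<in>J. a n *\<^sub>R xs n)"
  by (simp add: functional_values_def)

lemma functional_values_subseq:
  assumes "functional_values xs c C" "strict_mono (r :: nat \<Rightarrow> nat)"
  shows "functional_values (xs \<circ> r) (c \<circ> r) C"
  unfolding functional_values_def
proof (intro allI impI)
  fix a :: "nat \<Rightarrow> real" and J :: "nat set" assume J: "finite J"
  have inj: "inj r" using assms(2) by (rule strict_mono_imp_inj_on)
  then have injJ: "inj_on r J" by (rule inj_on_subset) simp
  have "\<bar>\<Sum>n\<in>r ` J. a (inv r n) * c n\<bar> \<le> C * norm (\<Sum>n\<in>r ` J. a (inv r n) *\<^sub>R xs n)"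
    using J by (intro functional_valuesD[OF assms(1)]) simp
  then show "\<bar>\<Sum>n\<in>J. a n * (c \<circ> r) n\<bar> \<le> C * norm (\<Sum>n\<in>J. a n *\<^sub>R (xs \<circ> r) n)"
    unfolding sum.reindex[OF injJ] by (simp add: inv_f_f[OF inj])
qed

text \<open>\<open>L\<close> times a coefficient splits as \<open>coef * d - coef * (d - L)\<close>.
  The first series converges because \<open>d\<close> comes from a bounded functional, the second
  converges absolutely because coefficients are bounded and \<open>d k - L\<close> is geometrically
  small. The partial sums of both are bounded by multiples of \<open>norm y\<close>.\<close>

lemma iso_polyhedral_functional_values:
  fixes xs :: "nat \<Rightarrow> 'a::banach"
  assumes b: "basic_sequence xs" and \<delta>: "\<delta> > 0" "\<And>n. \<delta> \<le> norm (xs n)"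
    and E: "iso_precisely_norming E"
    and sm: "\<forall>e\<in>E. summable (\<lambda>n. \<bar>blinfun_apply e (xs (Suc n) - xs n)\<bar>)"
    and d: "functional_values xs d C" "L \<noteq> 0" "\<And>k. \<bar>d k - L\<bar> \<le> (1/2) ^ k"
  shows "iso_polyhedral (closure (span (range xs)))"
proof -
  let ?Y = "closure (span (range xs))"
  obtain K where K: "K \<ge> 0" "\<And>y n. y \<in> ?Y \<Longrightarrow> norm (\<Sum>i<n. coef xs y i *\<^sub>R xs i) \<le> K * norm y"
    using basis_constant[OF b \<delta>] by blast
  obtain M where M: "M \<ge> 1" "\<And>y n. y \<in> ?Y \<Longrightarrow> \<bar>coef xs y n\<bar> * norm (xs n) \<le> M * norm y"
    using coef_bound[OF b \<delta>] by blast
  define \<kappa> where "\<kappa> = M / \<delta>"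
  have \<kappa>: "\<bar>coef xs y n\<bar> \<le> \<kappa> * norm y" if "y \<in> ?Y" for y n
  proof -
    have "\<bar>coef xs y n\<bar> * \<delta> \<le> \<bar>coef xs y n\<bar> * norm (xs n)" by (intro mult_left_mono \<delta>) simp
    also have "\<dots> \<le> M * norm y" by (rule M(2)[OF that])
    finally show ?thesis using \<delta>(1) by (simp add: \<kappa>_def pos_le_divide_eq)
  qed
  have fin: "\<bar>\<Sum>k\<in>J. coef xs y k * d k\<bar> \<le> C * norm (\<Sum>k\<in>J. coef xs y k *\<^sub>R xs k)" if "finite J" for y J
    using d(1) that by (rule functional_valuesD)
  have half: "summable (\<lambda>k. (1/2::real) ^ k)" "(\<Sum>k. (1/2::real) ^ k) = 2"
    using geometric_sums[of "1/2::real"] by (auto simp: sums_iff)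
  have term_le: "norm (coef xs y k * (d k - L)) \<le> \<kappa> * norm y * (1/2) ^ k" if "y \<in> ?Y" for y k
  proof -
    have "\<bar>coef xs y k\<bar> * \<bar>d k - L\<bar> \<le> \<kappa> * norm y * (1/2) ^ k"
      by (rule mult_mono[OF \<kappa>[OF that] d(3) order_trans[OF abs_ge_zero \<kappa>[OF that]] abs_ge_zero])
    then show ?thesis by (simp add: abs_mult)
  qed
  have sm2: "summable (\<lambda>k. coef xs y k * (d k - L))" if "y \<in> ?Y" for y
    by (rule summable_comparison_test'[OF summable_mult[OF half(1), of "\<kappa> * norm y"], of 0])
      (rule term_le[OF that])
  \<comment> \<open>The functional is given on finite combinations only, so convergence comes from
    the Cauchy criterion.\<close>
  have sd: "summable (\<lambda>k. coef xs y k * d k)" if y: "y \<in> ?Y" for y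
    unfolding summable_Cauchy
  proof (intro allI impI)
    fix \<epsilon> :: real assume \<epsilon>: "\<epsilon> > 0"
    have "summable (\<lambda>k. coef xs y k *\<^sub>R xs k)" by (rule sums_summable[OF coef_sums[OF b y]])
    moreover have "\<epsilon> / (\<bar>C\<bar> + 1) > 0" using \<epsilon> by simp
    ultimately obtain N where N: "\<And>m n. m \<ge> N \<Longrightarrow> norm (\<Sum>k\<in>{m..<n}. coef xs y k *\<^sub>R xs k) < \<epsilon> / (\<bar>C\<bar> + 1)"
      unfolding summable_Cauchy by blast
    have "norm (\<Sum>k\<in>{m..<n}. coef xs y k * d k) < \<epsilon>" if m: "m \<ge> N" for m n
    proof -
      let ?v = "norm (\<Sum>k\<in>{m..<n}. coef xs y k *\<^sub>R xs k)"
      have "\<bar>\<Sum>k\<in>{m..<n}. coef xs y k * d k\<bar> \<le> C * ?v" by (rule fin) simp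
      also have "\<dots> \<le> (\<bar>C\<bar> + 1) * ?v" by (intro mult_right_mono) auto
      also have "\<dots> < (\<bar>C\<bar> + 1) * (\<epsilon> / (\<bar>C\<bar> + 1))" by (intro mult_strict_left_mono N m) auto
      also have "\<dots> = \<epsilon>" by simp
      finally show ?thesis by simp
    qed
    then show "\<exists>N. \<forall>m\<ge>N. \<forall>n. norm (\<Sum>k\<in>{m..<n}. coef xs y k * d k) < \<epsilon>" by blast
  qed
  show ?thesis
  proof (rule iso_polyhedral_bounded_sums[OF b E sm, where c = "(\<bar>C\<bar> * K + 2 * \<kappa>) / \<bar>L\<bar>"])
    fix y assume y: "y \<in> ?Y"
    have "summable (\<lambda>k. (1/L) * (coef xs y k * d k - coef xs y k * (d k - L)))"
      by (intro summable_mult summable_diff sd sm2 y)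
    moreover have "(1/L) * (coef xs y k * d k - coef xs y k * (d k - L)) = coef xs y k" for k
      using d(2) by (simp add: right_diff_distrib)
    ultimately show "summable (coef xs y)" by (simp only:)
    fix n
    have "L * (\<Sum>k<n. coef xs y k) = (\<Sum>k<n. coef xs y k * d k) - (\<Sum>k<n. coef xs y k * (d k - L))"
      unfolding sum_subtractf[symmetric] sum_distrib_left
      by (intro sum.cong) (simp_all add: algebra_simps)
    moreover have "\<bar>\<Sum>k<n. coef xs y k * d k\<bar> \<le> \<bar>C\<bar> * (K * norm y)"
    proof -
      have "\<bar>\<Sum>k<n. coef xs y k * d k\<bar> \<le> C * norm (\<Sum>k<n. coef xs y k *\<^sub>R xs k)" by (rule fin) simp
      also have "\<dots> \<le> \<bar>C\<bar> * norm (\<Sum>k<n. coef xs y k *\<^sub>R xs k)" by (intro mult_right_mono) auto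
      also have "\<dots> \<le> \<bar>C\<bar> * (K * norm y)" by (intro mult_left_mono K(2) y) auto
      finally show ?thesis .
    qed
    moreover have "\<bar>\<Sum>k<n. coef xs y k * (d k - L)\<bar> \<le> \<kappa> * norm y * 2"
    proof -
      have "\<bar>\<Sum>k<n. coef xs y k * (d k - L)\<bar> \<le> (\<Sum>k<n. \<kappa> * norm y * (1/2) ^ k)"
        by (rule order_trans[OF sum_abs sum_mono]) (use term_le[OF y] in simp)
      also have "\<dots> = \<kappa> * norm y * (\<Sum>k<n. (1/2) ^ k)" by (simp add: sum_distrib_left)
      also have "\<dots> \<le> \<kappa> * norm y * 2"
        using order_trans[OF abs_ge_zero \<kappa>[OF y]] sum_le_suminf[OF half(1), of "{..<n}"] half(2)
        by (intro mult_left_mono) auto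
      finally show ?thesis .
    qed
    ultimately have "\<bar>L\<bar> * \<bar>\<Sum>k<n. coef xs y k\<bar> \<le> \<bar>C\<bar> * (K * norm y) + \<kappa> * norm y * 2"
      unfolding abs_mult[symmetric] by linarith
    then show "\<bar>\<Sum>k<n. coef xs y k\<bar> \<le> (\<bar>C\<bar> * K + 2 * \<kappa>) / \<bar>L\<bar> * norm y"
      using d(2) by (simp add: field_simps)
  qed
qed

text \<open>The bounded sequence \<open>c\<close> has a limit point \<open>L\<close>, which is
  nonzero because it is taken along indices where \<open>c\<close> has modulus at least
  \<open>\<epsilon>\<close>. A subsequence approaching \<open>L\<close> at rate
  \<open>(1/2)^k\<close> meets the requirements of
  \<open>iso_polyhedral_functional_values\<close>.\<close>

lemma iso_polyhedral_subseq_not_null: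
  fixes xs :: "nat \<Rightarrow> 'a::banach"
  assumes b: "basic_sequence xs" and \<delta>: "\<delta> > 0" "\<And>n. \<delta> \<le> norm (xs n)"
    and E: "iso_precisely_norming E"
    and sm: "\<forall>e\<in>E. summable (\<lambda>n. \<bar>blinfun_apply e (xs (Suc n) - xs n)\<bar>)"
    and bdd: "\<And>n. norm (xs n) \<le> M"
    and c: "functional_values xs c C" "\<not> c \<longlonglongrightarrow> 0"
  shows "\<exists>r::nat \<Rightarrow> nat. strict_mono r \<and> iso_polyhedral (closure (span (range (xs \<circ> r))))"
proof -
  have cM: "\<bar>c n\<bar> \<le> \<bar>C\<bar> * M" for n
  proof -
    have "\<bar>c n\<bar> \<le> C * norm (xs n)" using functional_valuesD[OF c(1), of "{n}" "\<lambda>_. 1"] by simp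
    also have "\<dots> \<le> \<bar>C\<bar> * norm (xs n)" by (intro mult_right_mono) auto
    also have "\<dots> \<le> \<bar>C\<bar> * M" by (intro mult_left_mono bdd) simp
    finally show ?thesis .
  qed
  obtain \<epsilon> where \<epsilon>: "\<epsilon> > 0" "\<And>n. \<exists>m\<ge>n. \<epsilon> \<le> \<bar>c m\<bar>"
    using c(2) unfolding lim_sequentially by (auto simp: dist_real_def not_less)
  have "\<exists>m>n. \<epsilon> \<le> \<bar>c m\<bar>" for n using \<epsilon>(2)[of "Suc n"] by (auto simp: Suc_le_eq)
  then obtain r1 :: "nat \<Rightarrow> nat" where r1: "strict_mono r1" "\<And>k. \<epsilon> \<le> \<bar>c (r1 k)\<bar>"
    using exists_strict_mono[of "\<lambda>k m. \<epsilon> \<le> \<bar>c m\<bar>"] by blast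
  have "bounded (range (c \<circ> r1))" using cM by (auto simp: bounded_iff)
  then obtain L r2 where r2: "strict_mono (r2 :: nat \<Rightarrow> nat)" "((c \<circ> r1) \<circ> r2) \<longlonglongrightarrow> L"
    using bounded_imp_convergent_subsequence by blast
  have "\<epsilon> \<le> \<bar>L\<bar>" using LIMSEQ_le_const[OF tendsto_rabs[OF r2(2)]] r1(2) by auto
  then have L: "L \<noteq> 0" using \<epsilon>(1) by auto
  have r12: "strict_mono (r1 \<circ> r2)" using r1(1) r2(1) by (rule strict_mono_o)
  have "\<exists>m>n. \<bar>c m - L\<bar> \<le> (1/2) ^ k" for k n :: nat
  proof -
    have "(1/2::real) ^ k > 0" by simp
    then obtain N where N: "\<And>i. i \<ge> N \<Longrightarrow> dist (((c \<circ> r1) \<circ> r2) i) L < (1/2) ^ k"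
      using r2(2) unfolding lim_sequentially by blast
    let ?i = "max N (Suc n)"
    have "n < (r1 \<circ> r2) ?i" using seq_suble[OF r12, of ?i] by linarith
    moreover have "\<bar>c ((r1 \<circ> r2) ?i) - L\<bar> \<le> (1/2) ^ k" using N[of ?i] by (simp add: dist_real_def)
    ultimately show ?thesis by blast
  qed
  then obtain r :: "nat \<Rightarrow> nat" where r: "strict_mono r" "\<And>k. \<bar>c (r k) - L\<bar> \<le> (1/2) ^ k"
    using exists_strict_mono[of "\<lambda>k m. \<bar>c m - L\<bar> \<le> (1/2) ^ k"] by blast
  have "iso_polyhedral (closure (span (range (xs \<circ> r))))"
  proof (rule iso_polyhedral_functional_values[OF basic_sequence_subseq[OF b \<delta> r(1)] \<delta>(1) _ E _
        functional_values_subseq[OF c(1) r(1)] L])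
    show "\<delta> \<le> norm ((xs \<circ> r) n)" for n using \<delta>(2) by simp
    show "\<bar>(c \<circ> r) k - L\<bar> \<le> (1/2) ^ k" for k using r(2) by simp
    show "\<forall>e\<in>E. summable (\<lambda>n. \<bar>blinfun_apply e ((xs \<circ> r) (Suc n) - (xs \<circ> r) n)\<bar>)"
    proof
      fix e assume "e \<in> E"
      then have "summable (\<lambda>n. \<bar>blinfun_apply e (xs (Suc n)) - blinfun_apply e (xs n)\<bar>)"
        using sm by (simp add: blinfun.diff_right)
      from summable_variation_subseq[OF this r(1)]
      show "summable (\<lambda>n. \<bar>blinfun_apply e ((xs \<circ> r) (Suc n) - (xs \<circ> r) n)\<bar>)"
        by (simp add: blinfun.diff_right)
    qed
  qed
  then show ?thesis using r(1) by blast
qed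

text \<open>When \<open>xs\<close> is weakly null, compactness yields for every \<open>n\<close> and \<open>t\<close> an \<open>N\<close> such that each
  \<open>e \<in> E\<close> drops below \<open>t\<close> on \<open>xs n, \<dots>, xs N\<close>. Along a subsequence that jumps over these \<open>N\<close>, a
  value of \<open>e\<close> is therefore paid for by its variation before the next jump.\<close>

lemma iso_polyhedral_subseq_null:
  fixes xs :: "nat \<Rightarrow> 'a::banach"
  assumes b: "basic_sequence xs" and \<delta>: "\<delta> > 0" "\<And>n. \<delta> \<le> norm (xs n)"
    and E: "iso_precisely_norming E"
    and sm: "\<forall>e\<in>E. summable (\<lambda>n. \<bar>blinfun_apply e (xs (Suc n) - xs n)\<bar>)"
    and bdd: "\<And>n. norm (xs n) \<le> M"
    and null: "\<And>c C. functional_values xs c C \<Longrightarrow> c \<longlonglongrightarrow> 0"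
  shows "\<exists>r::nat \<Rightarrow> nat. strict_mono r \<and> iso_polyhedral (closure (span (range (xs \<circ> r))))"
proof -
  obtain C where C: "C \<ge> 1" "\<And>e. e \<in> E \<Longrightarrow> norm e \<le> C"
    using E unfolding iso_precisely_norming_def by blast
  have eC: "\<bar>blinfun_apply e x\<bar> \<le> C * norm x" if "e \<in> E" for e x
    using norm_blinfun[of e x] mult_right_mono[OF C(2)[OF that] norm_ge_zero[of x]] by simp
  have drop: "\<exists>N\<ge>n. \<forall>e\<in>E. \<exists>i\<in>{n..N}. \<bar>blinfun_apply e (xs i)\<bar> < t" if t: "t > 0" for n t
  proof (rule ccontr)
    assume not: "\<not> ?thesis"
    have "\<forall>N. \<exists>e. e \<in> E \<and> (\<forall>i. n \<le> i \<longrightarrow> i \<le> N \<longrightarrow> t \<le> \<bar>blinfun_apply e (xs i)\<bar>)"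
    proof
      fix N
      have "\<exists>e\<in>E. \<forall>i\<in>{n..max n N}. \<not> \<bar>blinfun_apply e (xs i)\<bar> < t" using not by auto
      then show "\<exists>e. e \<in> E \<and> (\<forall>i. n \<le> i \<longrightarrow> i \<le> N \<longrightarrow> t \<le> \<bar>blinfun_apply e (xs i)\<bar>)"
        by (force simp: not_less)
    qed
    then obtain e where e: "\<And>N. e N \<in> E" "\<And>N i. n \<le> i \<Longrightarrow> i \<le> N \<Longrightarrow> t \<le> \<bar>blinfun_apply (e N) (xs i)\<bar>"
      by metis
    have "norm (blinfun_apply (e N) (xs i)) \<le> C * M" for N i
    proof -
      have "C * norm (xs i) \<le> C * M" using C(1) by (intro mult_left_mono bdd) simp
      then show ?thesis using eC[OF e(1), of N "xs i"] unfolding real_norm_def by linarith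
    qed
    then obtain s where s: "strict_mono s" "\<And>i. \<exists>l. (\<lambda>N. blinfun_apply (e (s N)) (xs i)) \<longlonglongrightarrow> l"
      using function_convergent_subsequence[of UNIV "\<lambda>N i. blinfun_apply (e N) (xs i)" "C * M"]
      by (metis UNIV_I countableI_type)
    then obtain c where c: "\<And>i. (\<lambda>N. blinfun_apply (e (s N)) (xs i)) \<longlonglongrightarrow> c i" by metis
    \<comment> \<open>Pointwise limits of elements of \<open>E\<close> along \<open>xs\<close> keep
      the constant \<open>C\<close>. This limit has modulus at least \<open>t\<close> from index
      \<open>n\<close> on, against \<open>null\<close>.\<close>
    have "functional_values xs c C" unfolding functional_values_def
    proof (intro allI impI)
      fix a :: "nat \<Rightarrow> real" and J :: "nat set" assume "finite J"
      have "\<bar>\<Sum>n\<in>J. a n * blinfun_apply (e (s N)) (xs n)\<bar> \<le> C * norm (\<Sum>n\<in>J. a n *\<^sub>R xs n)" for N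
        using eC[OF e(1), of "s N" "\<Sum>n\<in>J. a n *\<^sub>R xs n"] by (simp add: blinfun.sum_right blinfun.scaleR_right)
      moreover have "(\<lambda>N. \<bar>\<Sum>n\<in>J. a n * blinfun_apply (e (s N)) (xs n)\<bar>) \<longlonglongrightarrow> \<bar>\<Sum>n\<in>J. a n * c n\<bar>"
        by (intro tendsto_intros c)
      ultimately show "\<bar>\<Sum>n\<in>J. a n * c n\<bar> \<le> C * norm (\<Sum>n\<in>J. a n *\<^sub>R xs n)"
        by (intro LIMSEQ_le_const2) auto
    qed
    then have "c \<longlonglongrightarrow> 0" by (rule null)
    then obtain i0 where i0: "\<And>i. i \<ge> i0 \<Longrightarrow> \<bar>c i\<bar> < t"
      using t unfolding lim_sequentially by (auto simp: dist_real_def)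
    let ?i = "max i0 n"
    have "t \<le> \<bar>c ?i\<bar>"
    proof (rule LIMSEQ_le_const[OF tendsto_rabs[OF c]])
      have "t \<le> \<bar>blinfun_apply (e (s N)) (xs ?i)\<bar>" if "N \<ge> ?i" for N
        using e(2)[of ?i "s N"] seq_suble[OF s(1), of N] that by simp
      then show "\<exists>N. \<forall>n\<ge>N. t \<le> \<bar>blinfun_apply (e (s n)) (xs ?i)\<bar>" by blast
    qed
    then show False using i0[of ?i] by simp
  qed
  have "\<forall>k n. \<exists>N\<ge>n. \<forall>e\<in>E. \<exists>i\<in>{n..N}. \<bar>blinfun_apply e (xs i)\<bar> < (1/2::real) ^ k"
    using drop by simp
  then obtain \<phi> where \<phi>: "\<And>k n. n \<le> \<phi> k n"
    "\<And>k n e. e \<in> E \<Longrightarrow> \<exists>i\<in>{n..\<phi> k n}. \<bar>blinfun_apply e (xs i)\<bar> < (1/2::real) ^ k" by metis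
  \<comment> \<open>With the \<open>Suc\<close>, the index where \<open>e\<close> is small falls
    into the half-open block from \<open>r k\<close> to \<open>r (Suc k)\<close>, so different
    \<open>k\<close> use variation over disjoint blocks.\<close>
  define r where "r = rec_nat 0 (\<lambda>k n. Suc (\<phi> k n))"
  have rS: "r (Suc k) = Suc (\<phi> k (r k))" for k by (simp add: r_def)
  have r: "strict_mono r" unfolding strict_mono_Suc_iff rS using \<phi>(1) by (simp add: less_Suc_eq_le)
  have "iso_polyhedral (closure (span (range (xs \<circ> r))))"
  proof (rule iso_polyhedral_summable[OF basic_sequence_subseq[OF b \<delta> r] \<delta>(1) _ E])
    show "\<delta> \<le> norm ((xs \<circ> r) n)" for n using \<delta>(2) by simp
    fix e assume e: "e \<in> E"
    let ?f = "\<lambda>n. blinfun_apply e (xs n)"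
    let ?v = "\<lambda>n. \<bar>?f (Suc n) - ?f n\<bar>"
    have v: "summable ?v" using bspec[OF sm e] by (simp add: blinfun.diff_right)
    show "summable (\<lambda>k. \<bar>blinfun_apply e ((xs \<circ> r) k)\<bar> / norm ((xs \<circ> r) k))"
    proof (rule summable_comparison_test')
      show "summable (\<lambda>k. ((1/2::real) ^ k + (\<Sum>n\<in>{r k..<r (Suc k)}. ?v n)) / \<delta>)"
        by (intro summable_divide summable_add summable_geometric summable_blocks v r) auto
      fix k
      obtain i where i: "r k \<le> i" "i \<le> \<phi> k (r k)" "\<bar>?f i\<bar> < (1/2) ^ k" using \<phi>(2)[OF e, of "r k" k] by auto
      have "\<bar>?f i - ?f (r k)\<bar> \<le> (\<Sum>n\<in>{r k..<i}. ?v n)" by (rule abs_diff_le_variation[OF i(1)])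
      also have "\<dots> \<le> (\<Sum>n\<in>{r k..<r (Suc k)}. ?v n)" by (rule sum_mono2) (use i(2) rS[of k] in auto)
      finally have "\<bar>?f (r k)\<bar> \<le> (1/2) ^ k + (\<Sum>n\<in>{r k..<r (Suc k)}. ?v n)" using i(3) by linarith
      then have "\<bar>?f (r k)\<bar> / norm (xs (r k)) \<le> ((1/2) ^ k + (\<Sum>n\<in>{r k..<r (Suc k)}. ?v n)) / \<delta>"
        using \<delta> by (intro frac_le) (auto intro: add_nonneg_nonneg sum_nonneg)
      then show "norm (\<bar>blinfun_apply e ((xs \<circ> r) k)\<bar> / norm ((xs \<circ> r) k))
          \<le> ((1/2) ^ k + (\<Sum>n\<in>{r k..<r (Suc k)}. ?v n)) / \<delta>" by simp
    qed
  qed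
  then show ?thesis using r by blast
qed

theorem theorem3p2:
  fixes xs :: "nat \<Rightarrow> 'a::banach"
    and E :: "('a \<Rightarrow>\<^sub>L real) set"
  assumes "basic_sequence xs"
    and "\<exists>\<delta>>0. \<forall>n. \<delta> \<le> norm (xs n)"
    and "iso_precisely_norming E"
    and "\<forall>e\<in>E. summable (\<lambda>n. \<bar>blinfun_apply e (xs (Suc n) - xs n)\<bar>)"
  shows "\<exists>r::nat \<Rightarrow> nat. strict_mono r \<and> iso_polyhedral (closure (span (range (xs \<circ> r))))"
proof -
  obtain \<delta> where \<delta>: "\<delta> > 0" "\<And>n. \<delta> \<le> norm (xs n)" using assms(2) by blast
  show ?thesis
  proof (cases "Bseq xs")
    case False
    then show ?thesis by (rule iso_polyhedral_subseq_unbounded[OF assms(1) \<delta> assms(3,4)])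
  next
    case True
    then obtain M where M: "\<And>n. norm (xs n) \<le> M" unfolding Bseq_def by blast
    show ?thesis
    \<comment> \<open>For bounded norms, what matters is whether every bounded functional on the
      span tends to 0 along \<open>xs\<close>; a functional that does not supplies the nonzero
      limit.\<close>
    proof (cases "\<forall>c C. functional_values xs c C \<longrightarrow> c \<longlonglongrightarrow> 0")
      case True
      then show ?thesis by (intro iso_polyhedral_subseq_null[OF assms(1) \<delta> assms(3,4) M]) auto
    next
      case False
      then show ?thesis using iso_polyhedral_subseq_not_null[OF assms(1) \<delta> assms(3,4) M] by blast
    qed
  qed
qed

end
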